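(* Let $n$ be a positive integer with $n\equiv 1\pmod 4$, and let $M=(n-1)/2$ or $M=n-1$. Then \[ \sum_{k=0}^{M}[6k+1]\frac{(q;q^2)_k^3(q;q^4)_k}{(q^2;q^2)_k(q^4;q^4)_k^3}q^{k^2+k} \equiv[n]q^{(1-n)/4}\frac{(q^2;q^4)_{(n-1)/4}}{(q^4;q^4)_{(n-1)/4}}\bigg\{1-[n]^2\sum_{j=1}^{(n-1)/4}\frac{q^{4j}}{[4j]^2}\bigg\}\pmod{[n]\Phi_n(q)^3}. \]
   Context: For a complex number $x$ and integer $n\ge 0$, $(x;q)_n=\prod_{j=0}^{n-1}(1-xq^j)$ (with $(x;q)_0=1$). $[r]=(1-q^r)/(1-q)$ denotes the $q$-integer, and $\Phi_n(q)$ is the $n$-th cyclotomic polynomial in $q$. A congruence $A(q)\equiv B(q)\pmod{P(q)}$ between rational functions in $q$ whose denominators are coprime to the polynomial $P(q)$ means that $A(q)-B(q)$ is a rational function whose numerator is divisible by $P(q)$ and whose denominator is coprime to $P(q)$. *)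

theory Defs
  imports
    "HOL-Complex_Analysis.Complex_Analysis"
    "HOL-Computational_Algebra.Computational_Algebra"
    "HOL-Number_Theory.Number_Theory"
begin

text \<open>
  Polynomials in \<open>q\<close> are elements of \<^typ>\<open>complex poly\<close>, rational functions in \<open>q\<close> are
  elements of its field of fractions \<^typ>\<open>complex poly fract\<close>; \<open>polq\<close> and \<open>ratq\<close> are
  the indeterminate \<open>q\<close> in either structure.
\<close>

abbreviation polq :: "complex poly" where
  "polq \<equiv> [:0, 1:]"

abbreviation ratq :: "complex poly fract" where
  "ratq \<equiv> to_fract polq"

definition qpochhammer :: "'a::comm_ring_1 \<Rightarrow> 'a \<Rightarrow> nat \<Rightarrow> 'a" where
  "qpochhammer x q n = (\<Prod>j<n. 1 - x * q ^ j)"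

text \<open>
  In a field, \<open>div\<close> is ordinary division.  In \<^typ>\<open>complex poly\<close> it is polynomial division,
  which is exact here because \<open>1 - q\<close> divides \<open>1 - q ^ r\<close>.
\<close>

definition qinteger :: "'a::idom_divide \<Rightarrow> nat \<Rightarrow> 'a" where
  "qinteger q r = (1 - q ^ r) div (1 - q)"

definition cyclotomic :: "nat \<Rightarrow> complex poly" where
  "cyclotomic n = (\<Prod>k | k \<in> {1..n} \<and> coprime k n. [:- cis (2 * pi * real k / real n), 1:])"

definition denom_coprime :: "complex poly fract \<Rightarrow> complex poly \<Rightarrow> bool" where
  "denom_coprime A P \<longleftrightarrow> (\<exists>a b. b \<noteq> 0 \<and> A = Fract a b \<and> coprime b P)"

text \<open>
  The congruence \<open>A \<equiv> B (mod P)\<close> is only meaningful if the denominators of \<open>A\<close> and \<open>B\<close> are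
  coprime to \<open>P\<close>; this is made part of the relation.
\<close>

definition ratfun_cong ::
    "complex poly fract \<Rightarrow> complex poly fract \<Rightarrow> complex poly \<Rightarrow> bool" where
  "ratfun_cong A B P \<longleftrightarrow> denom_coprime A P \<and> denom_coprime B P \<and>
     (\<exists>a b. b \<noteq> 0 \<and> A - B = Fract a b \<and> P dvd a \<and> coprime b P)"

end

theory Submission
  imports Defs
begin

text \<open>
  The summand belongs to the family in which \<open>(q;q\<^sup>2)\<^sub>k\<^sup>3 / (q\<^sup>4;q\<^sup>4)\<^sub>k\<^sup>3\<close> is replaced by
  \<open>(q u, q v, q w; q\<^sup>2)\<^sub>k / (q\<^sup>4/u, q\<^sup>4/v, q\<^sup>4/w; q\<^sup>4)\<^sub>k\<close> with \<open>u v w = 1\<close>, for which a quadratic summation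
  formula gives a closed form when \<open>u = q\<^bsup>- n\<^esup>\<close>, and the value \<open>0\<close> for all \<open>u\<close>, \<open>v\<close>, \<open>w\<close> when \<open>q\<close> is a root of
  unity of odd order \<open>d > 1\<close>.

  Take \<open>u = q\<^bsup>- n\<^esup>\<close>, \<open>v + w = 3 - u\<close>, \<open>v w = 1 / u\<close>. The elementary symmetric functions of \<open>u\<close>, \<open>v\<close>, \<open>w\<close>
  are then \<open>3\<close>, \<open>3 + x\<close>, \<open>1\<close> with \<open>x = (1 - u)\<^sup>3 / u\<close>, which differ from those of \<open>1\<close>, \<open>1\<close>, \<open>1\<close> only to third
  order at a primitive \<open>n\<close>-th root of unity. Since the sum vanishes there for every \<open>x\<close>, it changes only to fourth
  order when \<open>x\<close> is replaced by \<open>0\<close>, and the closed form expands to the right-hand side.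

  At a primitive \<open>d\<close>-th root of unity with \<open>d\<close> a proper divisor of \<open>n\<close>, the sum splits into blocks of length \<open>d\<close>
  that are proportional to the block starting at \<open>0\<close>, whose sum is \<open>0\<close>.
\<close>


text \<open>The choice of deformation: \<open>u\<close>, \<open>v\<close>, \<open>w\<close> are the
  roots of (y - 1)^3 + x y, and y = u gives x = (1 - u)^3 / u. Keeping u + v + w = 3 and u v w = 1
  thus pushes a perturbation of first order in 1 - q^n into a single coefficient, where it has order
  three. The price is that \<open>v\<close> and \<open>w\<close> involve a square root of 1 - 4 q^n
  and are not rational functions of q, so the summation formula has to be available in terms of v +
  w and v w alone.

  The modulus is read off pointwise: order 4 at the primitive n-th roots of unity, order 1 at the
  remaining n-th roots other than 1. The condition n \<equiv> 1 (mod 4) places 1 - q^n among the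
  factors of (q; q^4)_k for k > (n - 1) / 4. Summands beyond (n - 1) / 2 thereby get a fourth zero
  on top of the three from the cube of (q; q^2)_k, so both upper limits \<open>M\<close> give the
  same sum to the required order.\<close>

lemma qpochhammer_0 [simp]: "qpochhammer x q 0 = 1"
  by (simp add: qpochhammer_def)

lemma qpochhammer_Suc: "qpochhammer x q (Suc n) = qpochhammer x q n * (1 - x * q ^ n)"
  by (simp add: qpochhammer_def)

lemma qpochhammer_Suc': "qpochhammer x q (Suc n) = (1 - x) * qpochhammer (x * q) q n"
  unfolding qpochhammer_def prod.lessThan_Suc_shift by (simp add: mult_ac)

lemma qpochhammer_nonzero:
  fixes x q :: "'a::idom"
  assumes "\<And>j. j < n \<Longrightarrow> x * q ^ j \<noteq> 1"
  shows "qpochhammer x q n \<noteq> 0"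
proof -
  have "1 - x * q ^ j \<noteq> 0" if "j < n" for j
    using assms[OF that] by (metis eq_iff_diff_eq_0)
  then show ?thesis
    by (simp add: qpochhammer_def)
qed

lemma qpochhammer_zero:
  assumes "j < n" "x * q ^ j = 1"
  shows "qpochhammer x q n = 0"
  using assms by (auto simp: qpochhammer_def intro!: prod_zero bexI[of _ j])

section \<open>A quadratic summation\<close>

text \<open>
  This is the limit \<open>d \<rightarrow> \<infinity>\<close> of the summand of Rahman's quadratic summation (Gasper and Rahman, (3.8.12)).
  The exponent \<open>\<Sum>j\<le>k. j\<close> is \<open>k (k + 1) / 2\<close>.
\<close>

definition quadratic_term :: "'a::field \<Rightarrow> 'a \<Rightarrow> 'a \<Rightarrow> 'a \<Rightarrow> nat \<Rightarrow> 'a" where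
  "quadratic_term a b c q k = (1 - a * q ^ (3 * k)) * qpochhammer a (q\<^sup>2) k
     * qpochhammer b q k * qpochhammer c q k * qpochhammer (a * q / (b * c)) q k
     / (qpochhammer q q k * qpochhammer (a * q\<^sup>2 / b) (q\<^sup>2) k
        * qpochhammer (a * q\<^sup>2 / c) (q\<^sup>2) k * qpochhammer (b * c * q) (q\<^sup>2) k)
     * q ^ (\<Sum>j\<le>k. j)"

text \<open>
  The Wilf--Zeilberger companion for the shift of \<open>a\<close> to \<open>a q\<^sup>2\<close>.
\<close>

definition quadratic_cert :: "'a::field \<Rightarrow> 'a \<Rightarrow> 'a \<Rightarrow> 'a \<Rightarrow> nat \<Rightarrow> 'a" where
  "quadratic_cert a b c q k = a * q / (b * c) * (1 - a) * qpochhammer (a * q\<^sup>2) (q\<^sup>2) k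
     * qpochhammer b q (Suc k) * qpochhammer c q (Suc k) * qpochhammer (a * q\<^sup>2 / (b * c)) q k
     / (qpochhammer q q k * qpochhammer (a * q ^ 4 / b) (q\<^sup>2) k
        * qpochhammer (a * q ^ 4 / c) (q\<^sup>2) k * qpochhammer (b * c * q) (q\<^sup>2) k)
     * q ^ (\<Sum>j\<le>Suc k. j)"


text \<open>The step of \<open>quadratic_telescope\<close> from K to K + 1 after all common
  factorials are divided out, with \<open>x\<close> for q^(K + 1) / q = q^K and \<open>C\<close> for
  a q / (b c). Eliminating \<open>a\<close> in favour of \<open>C\<close> turns the denominator
  parameters into monomials, so that a polynomial identity remains.\<close>

lemma quadratic_step_identity:
  fixes b c C q x :: "'a::comm_ring_1"
  shows "(1 - b*c*C*q^2*x^3) * (1 - C) * (1 - C*c*q^3*x^2) * (1 - C*b*q^3*x^2)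
     - (1 - b*c*C*q^4*x^3) * (1 - b*c*C*q*x^2) * (1 - C*q*x) * (1 - C*q^2*x)
     = C * ((1 - b*c*C*q*x^2) * (1 - b*q*x) * (1 - c*q*x) * (1 - C*q*x) * (q^2*x)
            - (1 - q*x) * (1 - C*c*q^3*x^2) * (1 - C*b*q^3*x^2) * (1 - b*c*q*x^2))"
  by (simp add: algebra_simps power_numeral_reduce)

text \<open>In this and the two following cancellations every shifted factorial is a free letter, so
  the simplifier treats it as an atom instead of expanding products. The right-hand sides share the
  prefactor Z / E of \<open>quadratic_telescope\<close>.\<close>

lemma cert_cancel1:
  fixes u :: "'a::field"
  assumes "u \<noteq> 0" "v \<noteq> 0" "p \<noteq> 0" "n \<noteq> 0" "m \<noteq> 0" "r \<noteq> 0"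
  shows "u * v * (X*(Y*A)*B*H*(k*G)/(D0*p*(u*D1)*(v * D2)*(D3*r))*T) = (Y*A*B*H*G/(D0*D1*D2*D3)*T)/(p*n*m*r)*(X*k*n*m)"
  using assms by (simp add: divide_simps)
lemma cert_cancel2:
  fixes n :: "'a::field"
  assumes "p \<noteq> 0" "n \<noteq> 0" "m \<noteq> 0" "r \<noteq> 0"
  shows "Y*(X*(A*z)*B*H*(G*(k*l))/(D0*p*(D1*n)*(D2*m)*(D3*r))*T) = (Y*A*B*H*G/(D0*D1*D2*D3)*T)/(p*n*m*r)*(X*z*k*l)"
  using assms by (simp add: divide_simps)
lemma cert_cancel3:
  fixes n :: "'a::field"
  assumes "p \<noteq> 0" "n \<noteq> 0" "m \<noteq> 0" "r \<noteq> 0"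
  shows "C*Y*(A*z)*(B*k)*(H*l)*(G*g)/(D0*p*(D1*n)*(D2*m)*(D3*r))*(T*t) = (Y*A*B*H*G/(D0*D1*D2*D3)*T)/(p*n*m*r)*(C*(z*k*l*g*t))"
  using assms by (simp add: divide_simps)

text \<open>Telescoping in the upper limit: the increments of both sides agree by
  \<open>quadratic_step_identity\<close>. When the certificate on the right vanishes, a first-order
  recursion between the sums at a and a q^2 remains; both evaluations below come from it.\<close>

lemma quadratic_telescope:
  fixes a b c q :: "'a::field"
  assumes nz: "b \<noteq> 0" "c \<noteq> 0" "q \<noteq> 0"
    and q: "\<And>j. 0 < j \<Longrightarrow> j \<le> K \<Longrightarrow> q ^ j \<noteq> 1"
    and b: "\<And>j. j \<le> K \<Longrightarrow> a * q\<^sup>2 / b * (q\<^sup>2) ^ j \<noteq> 1"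
    and c: "\<And>j. j \<le> K \<Longrightarrow> a * q\<^sup>2 / c * (q\<^sup>2) ^ j \<noteq> 1"
    and bc: "\<And>j. j \<le> K \<Longrightarrow> b * c * q * (q\<^sup>2) ^ j \<noteq> 1"
  shows "(1 - a * q\<^sup>2 / b) * (1 - a * q\<^sup>2 / c) * (\<Sum>k\<le>K. quadratic_term a b c q k)
       - (1 - a) * (1 - a * q\<^sup>2 / (b * c)) * (\<Sum>k\<le>K. quadratic_term (a * q\<^sup>2) b c q k)
       = quadratic_cert a b c q K"
  using q b c bc
proof (induction K)
  case 0
  show ?case
    using nz by (simp add: quadratic_term_def quadratic_cert_def qpochhammer_Suc field_simps power2_eq_square)
next
  case (Suc K)
  define C where "C = a * q / (b * c)"
  have a: "a = b * c * C / q"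
    using nz by (simp add: C_def)
  define x where "x = q ^ K"
  \<comment> \<open>\<open>Z\<close> collects the factorials shared by all the expressions to be
    compared, \<open>E\<close> the last factors of the denominators at index K + 1.\<close>
  define Z where "Z = (1 - a) * qpochhammer (a * q\<^sup>2) (q\<^sup>2) K
     * qpochhammer b q (Suc K) * qpochhammer c q (Suc K) * qpochhammer (C * q) q K
     / (qpochhammer q q K * qpochhammer (a * q ^ 4 / b) (q\<^sup>2) K
        * qpochhammer (a * q ^ 4 / c) (q\<^sup>2) K * qpochhammer (b * c * q) (q\<^sup>2) K)
     * q ^ (\<Sum>j\<le>Suc K. j)"
  define E where "E = (1 - q * x) * (1 - C*c*q^3*x^2) * (1 - C*b*q^3*x^2) * (1 - b*c*q*x^2)"
  have x2: "(q\<^sup>2) ^ K = x\<^sup>2" "q ^ (3 * Suc K) = q ^ 3 * x ^ 3"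
    by (simp add: x_def mult.commute flip: power_mult)
       (simp add: x_def power_add mult.commute flip: power_mult)
  have eqs: "a * q\<^sup>2 / b = C*c*q" "a * q\<^sup>2 / c = C*b*q" "a * q ^ 4 / b = C*c*q^3" "a * q ^ 4 / c = C*b*q^3"
     "a * q\<^sup>2 / (b * c) = C * q" "a * q / (b * c) = C" "a * q\<^sup>2 * q\<^sup>2 / b = C*c*q^3" "a * q\<^sup>2 * q\<^sup>2 / c = C*b*q^3"
     "a * q\<^sup>2 * q / (b * c) = C * q\<^sup>2"
    using nz by (simp_all add: a field_simps power_numeral_reduce)
  have eqs2: "a * q ^ 2 = b*c*C*q" "a * q ^ 3 = b*c*C*q\<^sup>2" "a * q\<^sup>2 * q ^ 3 = b*c*C*q^4"
    using nz by (simp_all add: a field_simps power_numeral_reduce)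
  have n1: "1 - q * x \<noteq> 0"
    using Suc.prems(1)[of "Suc K"] by (simp add: x_def)
  have n2: "1 - C*c*q^3*x^2 \<noteq> 0" "1 - C*c*q \<noteq> 0"
  proof -
    have "a * q\<^sup>2 / b * (q\<^sup>2) ^ Suc K = C*c*q^3*x^2"
      unfolding eqs power_Suc x2 by (simp add: power_numeral_reduce mult_ac)
    then have "C*c*q^3*x^2 \<noteq> 1"
      using Suc.prems(2)[of "Suc K"] by (metis order.refl)
    moreover have "C*c*q \<noteq> 1"
      using Suc.prems(2)[of 0] unfolding eqs by simp
    ultimately show "1 - C*c*q^3*x^2 \<noteq> 0" "1 - C*c*q \<noteq> 0"
      by auto
  qed
  have n3: "1 - C*b*q^3*x^2 \<noteq> 0" "1 - C*b*q \<noteq> 0"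
  proof -
    have "a * q\<^sup>2 / c * (q\<^sup>2) ^ Suc K = C*b*q^3*x^2"
      unfolding eqs power_Suc x2 by (simp add: power_numeral_reduce mult_ac)
    then have "C*b*q^3*x^2 \<noteq> 1"
      using Suc.prems(3)[of "Suc K"] by (metis order.refl)
    moreover have "C*b*q \<noteq> 1"
      using Suc.prems(3)[of 0] unfolding eqs by simp
    ultimately show "1 - C*b*q^3*x^2 \<noteq> 0" "1 - C*b*q \<noteq> 0"
      by auto
  qed
  have n4: "1 - b*c*q*x^2 \<noteq> 0"
    using Suc.prems(4)[of K] by (simp add: x2)
  have E0: "E \<noteq> 0"
    using n1 n2 n3 n4 by (simp add: E_def)
  have p1: "qpochhammer C q (Suc K) = (1 - C) * qpochhammer (C * q) q K"
    "qpochhammer (C*c*q) (q\<^sup>2) (Suc K) = (1 - C*c*q) * qpochhammer (C*c*q^3) (q\<^sup>2) K"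
    "qpochhammer (C*b*q) (q\<^sup>2) (Suc K) = (1 - C*b*q) * qpochhammer (C*b*q^3) (q\<^sup>2) K"
    "qpochhammer a (q\<^sup>2) (Suc K) = (1 - a) * qpochhammer (a * q\<^sup>2) (q\<^sup>2) K"
    by (simp_all add: qpochhammer_Suc' power2_eq_square power3_eq_cube mult_ac)
  have p2: "qpochhammer q q (Suc K) = qpochhammer q q K * (1 - q * x)"
    "qpochhammer (b * c * q) (q\<^sup>2) (Suc K) = qpochhammer (b * c * q) (q\<^sup>2) K * (1 - b * c * q * x\<^sup>2)"
    "qpochhammer (C*c*q^3) (q\<^sup>2) (Suc K) = qpochhammer (C*c*q^3) (q\<^sup>2) K * (1 - C*c*q^3 * x\<^sup>2)"
    "qpochhammer (C*b*q^3) (q\<^sup>2) (Suc K) = qpochhammer (C*b*q^3) (q\<^sup>2) K * (1 - C*b*q^3 * x\<^sup>2)"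
    "qpochhammer (a * q\<^sup>2) (q\<^sup>2) (Suc K) = qpochhammer (a * q\<^sup>2) (q\<^sup>2) K * (1 - b*c*C*q*x\<^sup>2)"
    "qpochhammer b q (Suc (Suc K)) = qpochhammer b q (Suc K) * (1 - b * q * x)"
    "qpochhammer c q (Suc (Suc K)) = qpochhammer c q (Suc K) * (1 - c * q * x)"
    "qpochhammer (C * q) q (Suc K) = qpochhammer (C * q) q K * (1 - C * q * x)"
    using nz by (simp_all add: qpochhammer_Suc x2 x_def[symmetric] mult.assoc eqs2)
  have "(1 - C * q) * qpochhammer (C * q\<^sup>2) q (Suc K) = qpochhammer (C * q) q (Suc (Suc K))"
    by (simp add: qpochhammer_Suc'[of "C * q"] power2_eq_square mult_ac)
  also have "\<dots> = qpochhammer (C * q) q K * ((1 - C * q * x) * (1 - C * q\<^sup>2 * x))"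
    by (simp add: qpochhammer_Suc x_def power2_eq_square mult_ac)
  finally have p3: "qpochhammer (C * q\<^sup>2) q (Suc K) * (1 - C * q) = qpochhammer (C * q) q K * ((1 - C * q * x) * (1 - C * q\<^sup>2 * x))"
    by (simp add: mult.commute)
  have e3: "1 - a * q ^ (3 * Suc K) = 1 - b*c*C*q^2*x^3" "1 - a * q\<^sup>2 * q ^ (3 * Suc K) = 1 - b*c*C*q^4*x^3"
    using eqs2 unfolding x2 by (simp_all flip: mult.assoc)
  have t1: "(1 - a * q\<^sup>2 / b) * (1 - a * q\<^sup>2 / c) * quadratic_term a b c q (Suc K)
     = Z / E * ((1 - b*c*C*q^2*x^3) * (1 - C) * (1 - C*c*q^3*x^2) * (1 - C*b*q^3*x^2))"
    unfolding quadratic_term_def Z_def E_def eqs p1 p2 e3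
    by (rule cert_cancel1) (fact n1 n2 n3 n4)+
  have t2: "(1 - a) * (1 - a * q\<^sup>2 / (b * c)) * quadratic_term (a * q\<^sup>2) b c q (Suc K)
     = Z / E * ((1 - b*c*C*q^4*x^3) * (1 - b*c*C*q*x^2) * (1 - C*q*x) * (1 - C*q^2*x))"
  proof -
    have "(1 - a) * (1 - a * q\<^sup>2 / (b * c)) * quadratic_term (a * q\<^sup>2) b c q (Suc K)
      = (1 - a) * ((1 - b*c*C*q^4*x^3) * (qpochhammer (a * q\<^sup>2) (q\<^sup>2) K * (1 - b*c*C*q*x\<^sup>2))
         * qpochhammer b q (Suc K) * qpochhammer c q (Suc K) * (qpochhammer (C * q\<^sup>2) q (Suc K) * (1 - C * q))
     / (qpochhammer q q K * (1 - q * x) * (qpochhammer (C*c*q^3) (q\<^sup>2) K * (1 - C*c*q^3 * x\<^sup>2))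
        * (qpochhammer (C*b*q^3) (q\<^sup>2) K * (1 - C*b*q^3 * x\<^sup>2)) * (qpochhammer (b * c * q) (q\<^sup>2) K * (1 - b * c * q * x\<^sup>2)))
     * q ^ (\<Sum>j\<le>Suc K. j))"
      unfolding quadratic_term_def eqs p2 e3 by (simp only: mult_ac times_divide_eq_left times_divide_eq_right)
    then show ?thesis
      unfolding p3 Z_def E_def eqs by (simp only: cert_cancel2 [OF n1 n2(1) n3(1) n4])
  qed
  have t3: "quadratic_cert a b c q K = Z / E * (C * E)"
    unfolding quadratic_cert_def Z_def eqs using E0 by (simp add: mult_ac)
  have t4: "quadratic_cert a b c q (Suc K) = Z / E *
      (C * ((1 - b*c*C*q*x^2) * (1 - b*q*x) * (1 - c*q*x) * (1 - C*q*x) * (q^2*x)))"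
  proof -
    have T: "q ^ (\<Sum>j\<le>Suc (Suc K). j) = q ^ (\<Sum>j\<le>Suc K. j) * (q^2*x)"
      by (simp add: power_add x_def power2_eq_square mult_ac)
    have "quadratic_cert a b c q (Suc K) = C * (1 - a) * (qpochhammer (a * q\<^sup>2) (q\<^sup>2) K * (1 - b*c*C*q*x\<^sup>2))
     * (qpochhammer b q (Suc K) * (1 - b * q * x)) * (qpochhammer c q (Suc K) * (1 - c * q * x)) * (qpochhammer (C * q) q K * (1 - C * q * x))
     / (qpochhammer q q K * (1 - q * x) * (qpochhammer (C*c*q^3) (q\<^sup>2) K * (1 - C*c*q^3 * x\<^sup>2))
        * (qpochhammer (C*b*q^3) (q\<^sup>2) K * (1 - C*b*q^3 * x\<^sup>2)) * (qpochhammer (b * c * q) (q\<^sup>2) K * (1 - b * c * q * x\<^sup>2)))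
     * (q ^ (\<Sum>j\<le>Suc K. j) * (q^2*x))"
      unfolding quadratic_cert_def eqs p2 T ..
    then show ?thesis
      unfolding Z_def E_def eqs by (simp only: cert_cancel3 [OF n1 n2(1) n3(1) n4])
  qed
  have "(1 - a * q\<^sup>2 / b) * (1 - a * q\<^sup>2 / c) * quadratic_term a b c q (Suc K)
       - (1 - a) * (1 - a * q\<^sup>2 / (b * c)) * quadratic_term (a * q\<^sup>2) b c q (Suc K)
       = quadratic_cert a b c q (Suc K) - quadratic_cert a b c q K"
    unfolding t1 t2 t3 t4 right_diff_distrib [symmetric] quadratic_step_identity E_def ..
  moreover have "(1 - a * q\<^sup>2 / b) * (1 - a * q\<^sup>2 / c) * (\<Sum>k\<le>K. quadratic_term a b c q k)
       - (1 - a) * (1 - a * q\<^sup>2 / (b * c)) * (\<Sum>k\<le>K. quadratic_term (a * q\<^sup>2) b c q k)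
       = quadratic_cert a b c q K"
    using Suc.prems by (intro Suc.IH) auto
  moreover have "u * (x + y) - v * (x' + y') = (u * x - v * x') + (u * y - v * y')" for u v x x' y y' :: 'a
    by (simp add: algebra_simps)
  ultimately show ?case
    by (simp only: sum.atMost_Suc) simp
qed

text \<open>With a = q^(-2 m) the shift of \<open>a\<close> lowers m by one. For m > 0 the last
  summand at the shifted parameter and the certificate both contain (a q^2; q^2)_m = 0; for m = 0
  the factor 1 - a kills the only summand. Only the powers q^j with 0 < j \<le> m must differ from
  1, which leaves room for roots of unity.\<close>

lemma quadratic_sum_eq_0:
  fixes a b c q :: "'a::field"
  assumes "b \<noteq> 0" "c \<noteq> 0" "q \<noteq> 0"
    and "a * (q\<^sup>2) ^ m = 1"
    and "\<And>j. 0 < j \<Longrightarrow> j \<le> m \<Longrightarrow> q ^ j \<noteq> 1"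
    and "\<And>j. a * q\<^sup>2 / b * (q\<^sup>2) ^ j \<noteq> 1"
    and "\<And>j. a * q\<^sup>2 / c * (q\<^sup>2) ^ j \<noteq> 1"
    and "\<And>j. b * c * q * (q\<^sup>2) ^ j \<noteq> 1"
  shows "(\<Sum>k\<le>m. quadratic_term a b c q k) = 0"
  using assms
proof (induction m arbitrary: a)
  case 0
  then show ?case by (simp add: quadratic_term_def)
next
  case (Suc m)
  have am: "a * q\<^sup>2 * (q\<^sup>2) ^ m = 1"
    using Suc.prems(4) by (simp add: mult_ac)
  have shift: "a * q\<^sup>2 * q\<^sup>2 / x * (q\<^sup>2) ^ j = a * q\<^sup>2 / x * (q\<^sup>2) ^ Suc j" for x j
    by (simp add: mult_ac)
  have "(\<Sum>k\<le>m. quadratic_term (a * q\<^sup>2) b c q k) = 0"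
    using Suc.prems(1-3,5,8) am
    by (intro Suc.IH) (auto simp only: shift intro!: Suc.prems(6,7))
  moreover have z: "qpochhammer (a * q\<^sup>2) (q\<^sup>2) (Suc m) = 0"
    using am by (rule qpochhammer_zero[rotated]) simp
  then have "quadratic_term (a * q\<^sup>2) b c q (Suc m) = 0"
    by (simp add: quadratic_term_def)
  moreover have "quadratic_cert a b c q (Suc m) = 0"
    using z by (simp add: quadratic_cert_def)
  moreover have "1 - a * q\<^sup>2 / b \<noteq> 0" "1 - a * q\<^sup>2 / c \<noteq> 0"
    using Suc.prems(6)[of 0] Suc.prems(7)[of 0] by auto
  ultimately show ?case
    using quadratic_telescope[of b c q "Suc m" a] Suc.prems by (simp del: sum.atMost_Suc) simp
qed

section \<open>The terminating case b = q^(-2 s)\<close>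

definition quadratic_value :: "'a::field \<Rightarrow> 'a \<Rightarrow> 'a \<Rightarrow> 'a \<Rightarrow> nat \<Rightarrow> 'a" where
  "quadratic_value a b c q s = (1 - a) * qpochhammer (a * q\<^sup>2) (q\<^sup>2) s * qpochhammer (b * q) (q\<^sup>2) s
     / (qpochhammer (b * c * q) (q\<^sup>2) s * qpochhammer (a * q\<^sup>2 / c) (q\<^sup>2) s)"

text \<open>The two exponents differ in parity, and no positive power of \<open>q\<close> is 1. In
  the special evaluation this keeps factors 1 - q^i / q^j in the denominators away from
  zero.\<close>

lemma odd_power_ratio_neq_1:
  fixes q :: "'a::field"
  assumes "q \<noteq> 0" "\<And>i. 0 < i \<Longrightarrow> q ^ i \<noteq> 1" "even i" "odd j"
  shows "q ^ i / q ^ j \<noteq> 1"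
proof
  assume "q ^ i / q ^ j = 1"
  then have e: "q ^ i = q ^ j"
    using assms(1) by (simp add: field_simps)
  have "i \<noteq> j"
    using assms(3,4) by auto
  then consider "i < j" | "j < i"
    by linarith
  then show False
  proof cases
    case 1
    have "q ^ (j - i) * q ^ i = q ^ j"
      using 1 by (simp flip: power_add)
    then show False
      using assms(1) assms(2)[of "j - i"] 1 e by simp
  next
    case 2
    have "q ^ (i - j) * q ^ j = q ^ i"
      using 2 by (simp flip: power_add)
    then show False
      using assms(1) assms(2)[of "i - j"] 2 e by simp
  qed
qed

text \<open>
  The shift of \<open>a\<close> turns \<open>a q / (b c) = q\<^bsup>- 2 j\<^esup>\<close> into \<open>q\<^bsup>- 2 (j - 1)\<^esup>\<close>, so that one ends at a sum
  with a single nonzero term.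
\<close>

lemma quadratic_sum_special:
  fixes a b c q :: "'a::field"
  assumes q: "q \<noteq> 0" "\<And>i. 0 < i \<Longrightarrow> q ^ i \<noteq> 1"
    and "a \<noteq> 0" "\<And>i. a * q ^ i \<noteq> 1" and K: "2 * s \<le> K"
    and "b * q ^ (2 * s) = 1" "c = a * q ^ (1 + 2 * s + 2 * j)"
  shows "(\<Sum>k\<le>K. quadratic_term a b c q k) = quadratic_value a b c q s"
  using assms(3,4,6,7)
proof (induction j arbitrary: a)
  case 0
  have bc: "b \<noteq> 0" "c \<noteq> 0"
    using 0 q by auto
  have bcq: "b * c * q = a * q\<^sup>2"
    using 0(3,4) by (simp add: power_add power2_eq_square mult_ac)
  have acb: "a * q\<^sup>2 / c = b * q"
    using bcq bc q by (simp add: field_simps power2_eq_square)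
  \<comment> \<open>Hence (1; q)_k = 0 for k > 0, and only the summand k = 0 survives.\<close>
  have C: "a * q / (b * c) = 1"
    using bcq bc q 0(1) by (simp add: field_simps power2_eq_square)
  have "quadratic_term a b c q k = 0" if "k > 0" for k
    using that by (simp add: quadratic_term_def C qpochhammer_zero[of 0])
  then have "(\<Sum>k\<le>K. quadratic_term a b c q k) = quadratic_term a b c q 0"
    by (intro sum.mono_neutral_cong_right[where S = "{0}", simplified]) auto
  also have "\<dots> = 1 - a"
    by (simp add: quadratic_term_def)
  finally have S: "(\<Sum>k\<le>K. quadratic_term a b c q k) = 1 - a" .
  have n1: "qpochhammer (a * q\<^sup>2) (q\<^sup>2) s \<noteq> 0"
  proof (intro qpochhammer_nonzero)
    fix j
    show "a * q\<^sup>2 * (q\<^sup>2) ^ j \<noteq> 1"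
      using 0(2)[of "2 + 2 * j"] by (simp only: power_add power_mult mult.assoc) simp
  qed
  have n2: "qpochhammer (b * q) (q\<^sup>2) s \<noteq> 0"
  proof (intro qpochhammer_nonzero)
    fix j
    have "b = inverse (q ^ (2 * s))"
      using 0(3) by (metis inverse_unique mult.commute)
    then have "b * q * (q\<^sup>2) ^ j = q / q ^ (2 * s) * q ^ (2 * j)"
      by (simp add: field_simps flip: power_mult)
    also have "\<dots> = inverse (q ^ (2 * s) / q ^ (2 * j + 1))"
      using q by (simp add: field_simps power_add)
    finally have eq: "b * q * (q\<^sup>2) ^ j = inverse (q ^ (2 * s) / q ^ (2 * j + 1))" .
    have "q ^ (2 * s) / q ^ (2 * j + 1) \<noteq> 1"
      by (rule odd_power_ratio_neq_1[OF q]) simp_all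
    then show "b * q * (q\<^sup>2) ^ j \<noteq> 1"
      unfolding eq inverse_eq_1_iff .
  qed
  show ?case
    unfolding S quadratic_value_def acb bcq using n1 n2 by simp
next
  case (Suc j)
  have bc: "b \<noteq> 0" "c \<noteq> 0"
    using Suc.prems q by auto
  have b': "b = inverse (q ^ (2 * s))"
    using Suc.prems(3) by (metis inverse_unique mult.commute)
  have b2: "a * q\<^sup>2 / b * (q\<^sup>2) ^ i = a * q ^ (2 + 2 * s + 2 * i)" for i
    unfolding b' power_mult[of q 2, symmetric] divide_inverse inverse_inverse_eq
    by (simp add: power_add power2_eq_square mult_ac)
  have c2: "a * q\<^sup>2 / c * (q\<^sup>2) ^ i = q ^ (2 + 2 * i) / q ^ (1 + 2 * s + 2 * Suc j)" for i
    unfolding Suc.prems(4) power_mult[of q 2, symmetric]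
    using Suc.prems(1) by (simp add: power_add power2_eq_square mult_ac)
  have bc2: "b * c * q * (q\<^sup>2) ^ i = a * q ^ (2 + 2 * Suc j + 2 * i)" for i
    unfolding b' Suc.prems(4) power_mult[of q 2, symmetric]
    using q(1) by (simp add: power_add power2_eq_square mult_ac)
  have nb: "a * q\<^sup>2 / b * (q\<^sup>2) ^ i \<noteq> 1" "b * c * q * (q\<^sup>2) ^ i \<noteq> 1" for i
    unfolding b2 bc2 by (rule Suc.prems(2))+
  have nc: "a * q\<^sup>2 / c * (q\<^sup>2) ^ i \<noteq> 1" for i
    unfolding c2 by (rule odd_power_ratio_neq_1[OF q]) auto
  have "a * q\<^sup>2 * q ^ i \<noteq> 1" for i
    using Suc.prems(2)[of "2 + i"] by (simp add: power_add mult_ac power2_eq_square)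
  moreover have "c = a * q\<^sup>2 * q ^ (1 + 2 * s + 2 * j)"
    using Suc.prems(4) by (simp add: power_add mult_ac power2_eq_square)
  ultimately have IH: "(\<Sum>k\<le>K. quadratic_term (a * q\<^sup>2) b c q k) = quadratic_value (a * q\<^sup>2) b c q s"
    using Suc.prems(1,3) q(1) by (intro Suc.IH) auto
  \<comment> \<open>Since b = q^(-2 s) and 2 s \<le> K, the boundary term contributes
    nothing.\<close>
  have "qpochhammer b q (Suc K) = 0"
    using Suc.prems(3) K by (intro qpochhammer_zero[of "2 * s"]) auto
  then have cert: "quadratic_cert a b c q K = 0"
    by (simp add: quadratic_cert_def)
  have tele: "(1 - a * q\<^sup>2 / b) * (1 - a * q\<^sup>2 / c) * (\<Sum>k\<le>K. quadratic_term a b c q k)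
     = (1 - a) * (1 - a * q\<^sup>2 / (b * c)) * quadratic_value (a * q\<^sup>2) b c q s"
  proof -
    have "(1 - a * q\<^sup>2 / b) * (1 - a * q\<^sup>2 / c) * (\<Sum>k\<le>K. quadratic_term a b c q k)
       - (1 - a) * (1 - a * q\<^sup>2 / (b * c)) * (\<Sum>k\<le>K. quadratic_term (a * q\<^sup>2) b c q k)
       = quadratic_cert a b c q K"
      using bc q nb nc by (intro quadratic_telescope) auto
    then show ?thesis
      unfolding IH cert by simp
  qed
  have n3: "1 - a * q\<^sup>2 / b \<noteq> 0" "1 - a * q\<^sup>2 / c \<noteq> 0"
    using nb(1)[of 0] nc[of 0] by auto
  have n4: "qpochhammer (a * q\<^sup>2 / c) (q\<^sup>2) s \<noteq> 0"
    by (intro qpochhammer_nonzero nc)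
  have n5: "qpochhammer (a * q\<^sup>2 * q\<^sup>2 / c) (q\<^sup>2) s \<noteq> 0"
    using nc[of "Suc _"] by (intro qpochhammer_nonzero) (simp add: mult_ac)
  have ab: "a * q\<^sup>2 / b = a * q\<^sup>2 * (q\<^sup>2) ^ s"
    unfolding b' power_mult[of q 2, symmetric] divide_inverse inverse_inverse_eq ..
  have "a * q\<^sup>2 / (b * c) = a * q\<^sup>2 / b / c"
    by simp
  then have abc: "a * q\<^sup>2 / (b * c) = a * q\<^sup>2 / c * (q\<^sup>2) ^ s"
    unfolding ab by simp
  have r1: "qpochhammer (a * q\<^sup>2) (q\<^sup>2) s * (1 - a * q\<^sup>2 / b) = (1 - a * q\<^sup>2) * qpochhammer (a * q\<^sup>2 * q\<^sup>2) (q\<^sup>2) s"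
    using qpochhammer_Suc[of "a * q\<^sup>2" "q\<^sup>2" s] qpochhammer_Suc'[of "a * q\<^sup>2" "q\<^sup>2" s]
    unfolding ab by simp
  have r2: "qpochhammer (a * q\<^sup>2 / c) (q\<^sup>2) s * (1 - a * q\<^sup>2 / (b * c)) = (1 - a * q\<^sup>2 / c) * qpochhammer (a * q\<^sup>2 * q\<^sup>2 / c) (q\<^sup>2) s"
    using qpochhammer_Suc[of "a * q\<^sup>2 / c" "q\<^sup>2" s] qpochhammer_Suc'[of "a * q\<^sup>2 / c" "q\<^sup>2" s]
    unfolding abc by simp
  \<comment> \<open>The closed form obeys the same recursion as the sum: a q^2 / b = a q^2 (q^2)^s
    gives exactly the factor that extends (a q^2; q^2)_s by one, and a q^2 / (b c) does the same for
    (a q^2 / c; q^2)_s.\<close>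
  have "(1 - a * q\<^sup>2 / b) * (1 - a * q\<^sup>2 / c) * quadratic_value a b c q s
     = (1 - a) * (1 - a * q\<^sup>2 / (b * c)) * quadratic_value (a * q\<^sup>2) b c q s"
  proof -
    have gen: "x * y * ((1 - a) * P * B / (D * R)) = (1 - a) * z * ((1 - a * q\<^sup>2) * P' * B / (D * R'))"
      if "P * x = (1 - a * q\<^sup>2) * P'" "R * z = y * R'" "R \<noteq> 0" "R' \<noteq> 0" for x y z P B D R P' R'
    proof -
      have "x * y * ((1 - a) * P * B / (D * R)) = (1 - a) * (P * x) * B / D * (y / R)"
        by (simp add: mult_ac)
      also have "y / R = z / R'"
        using that by (simp add: field_simps)
      finally show ?thesis
        unfolding that(1) by (simp add: mult_ac)
    qed
    show ?thesis
      unfolding quadratic_value_def by (rule gen[OF r1 r2 n4 n5])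
  qed
  with tele have "(1 - a * q\<^sup>2 / b) * (1 - a * q\<^sup>2 / c) * (\<Sum>k\<le>K. quadratic_term a b c q k)
     = (1 - a * q\<^sup>2 / b) * (1 - a * q\<^sup>2 / c) * quadratic_value a b c q s"
    by (rule trans[OF _ sym])
  then show ?case
    unfolding mult_cancel_left mult_eq_0_iff using n3 by blast
qed

lemma prod_lessThan_split:
  fixes f :: "nat \<Rightarrow> 'a::comm_monoid_mult"
  assumes "k \<le> K"
  shows "(\<Prod>j<k. f j) * (\<Prod>j=k..<K. f j) = (\<Prod>j<K. f j)"
  using prod.atLeastLessThan_concat[of 0 k K f] assms by (simp add: atLeast0LessThan)

text \<open>A value y is taken only at roots of x^2 - y x + A, hence at most twice, while
  \<open>c\<close> takes infinitely many values.\<close>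

lemma infinite_range_sum_inverse:
  fixes c :: "nat \<Rightarrow> 'a::field"
  assumes "inj c" "\<And>j. c j \<noteq> 0"
  shows "infinite (range (\<lambda>j. c j + A / c j))"
proof
  assume fin: "finite (range (\<lambda>j. c j + A / c j))"
  define h where "h = (\<lambda>x. x + A / x)"
  have F: "finite (h ` range c)"
    using fin by (simp add: h_def image_image)
  have "finite (h -` {y} \<inter> range c)" for y
  proof (rule finite_subset)
    show "finite {x. poly [:A, - y, 1:] x = 0}"
      by (rule poly_roots_finite) simp
    show "h -` {y} \<inter> range c \<subseteq> {x. poly [:A, - y, 1:] x = 0}"
      using assms(2) by (auto simp: h_def field_simps)
  qed
  then have "finite (h -` (h ` range c) \<inter> range c)"
    by (rule finite_finite_vimage_IntI[OF F])
  then have "finite (range c)"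
    by (rule finite_subset[rotated]) auto
  then show False
    using assms(1) finite_imageD[of c UNIV] by auto
qed

text \<open>
  For \<open>e = c + a q / (b c)\<close> this is the summation formula with parameters \<open>a\<close>, \<open>b\<close>, \<open>c\<close>. Both sides are
  polynomials in \<open>e\<close>, and the special values of \<open>c\<close> provide infinitely many such \<open>e\<close>. Stated in terms of \<open>e\<close>,
  the identity applies even when the corresponding \<open>c\<close> does not lie in the field.
\<close>

lemma quadratic_sum_symmetric:
  fixes a b q e :: "'a::field"
  assumes q: "q \<noteq> 0" "\<And>i. 0 < i \<Longrightarrow> q ^ i \<noteq> 1"
    and a: "a \<noteq> 0" "\<And>i. a * q ^ i \<noteq> 1" and K: "2 * s \<le> K"
    and b: "b * q ^ (2 * s) = 1"
  defines "w \<equiv> \<lambda>k. (1 - a * q ^ (3 * k)) * qpochhammer a (q\<^sup>2) k * qpochhammer b q k * q ^ (\<Sum>j\<le>k. j)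
        / (qpochhammer q q k * qpochhammer (a * q\<^sup>2 / b) (q\<^sup>2) k)"
    and "d \<equiv> \<lambda>j e. 1 - e * b * q * (q\<^sup>2) ^ j + a * b * q ^ 3 * ((q\<^sup>2) ^ j)\<^sup>2"
    and "m \<equiv> \<lambda>j e. 1 - e * q ^ j + a * q / b * (q ^ j)\<^sup>2"
  shows "(\<Sum>k\<le>K. w k * (\<Prod>j<k. m j e) * (\<Prod>j=k..<K. d j e))
     = (1 - a) * qpochhammer (a * q\<^sup>2) (q\<^sup>2) s * qpochhammer (b * q) (q\<^sup>2) s * (\<Prod>j=s..<K. d j e)"
proof -
  define A where "A = a * q / b"
  \<comment> \<open>The values of the third parameter to which \<open>quadratic_sum_special\<close>
    applies, indexed by its number of shifts.\<close>
  define c where "c j = a * q ^ (1 + 2 * s + 2 * j)" for j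
  have b0: "b \<noteq> 0"
    using b by auto
  have b': "b = inverse (q ^ (2 * s))"
    using b by (metis inverse_unique mult.commute)
  have c0: "c j \<noteq> 0" for j
    using q a by (simp add: c_def)
  have "inj c"
  proof (rule injI)
    fix i j
    assume "c i = c j"
    then have "q ^ (2 * i) = q ^ (2 * j)"
      using q a by (simp add: c_def power_add)
    then have "q ^ (2 * i) / q ^ (2 * j) = 1" 
      using q by simp
    then have "2 * i = 2 * j"
    proof (cases "2 * i" "2 * j" rule: linorder_cases)
      case less
      have "q ^ (2 * j - 2 * i) * q ^ (2 * i) = q ^ (2 * j)"
        using less by (simp flip: power_add)
      then show ?thesis
        using \<open>q ^ (2 * i) = q ^ (2 * j)\<close> q(1) q(2)[of "2 * j - 2 * i"] less by simp
    next
      case greater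
      have "q ^ (2 * i - 2 * j) * q ^ (2 * j) = q ^ (2 * i)"
        using greater by (simp flip: power_add)
      then show ?thesis
        using \<open>q ^ (2 * i) = q ^ (2 * j)\<close> q(1) q(2)[of "2 * i - 2 * j"] greater by simp
    qed auto
    then show "i = j" by simp
  qed
  then have inf: "infinite (range (\<lambda>j. c j + A / c j))"
    using c0 by (rule infinite_range_sum_inverse)
  have special: "(\<Sum>k\<le>K. w k * (\<Prod>j<k. m j (c i + A / c i)) * (\<Prod>j=k..<K. d j (c i + A / c i)))
     = (1 - a) * qpochhammer (a * q\<^sup>2) (q\<^sup>2) s * qpochhammer (b * q) (q\<^sup>2) s * (\<Prod>j=s..<K. d j (c i + A / c i))"
    (is "?l = ?r") for i
  proof -
    define C where "C = c i"
    have C0: "C \<noteq> 0"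
      using c0 by (simp add: C_def)
    define E where "E = C + A / C"
    \<comment> \<open>For e = C + A / C the quadratics \<open>m\<close> and \<open>d\<close> split
      into the linear factors of the original summand.\<close>
    have mE: "m j E = (1 - C * q ^ j) * (1 - a * q / (b * C) * q ^ j)" for j
      using C0 b0 by (simp add: m_def E_def A_def field_simps power2_eq_square)
    have dE: "d j E = (1 - b * C * q * (q\<^sup>2) ^ j) * (1 - a * q\<^sup>2 / C * (q\<^sup>2) ^ j)" for j
      using C0 b0 by (simp add: d_def E_def A_def field_simps power2_eq_square power3_eq_cube)
    have pm: "(\<Prod>j<k. m j E) = qpochhammer C q k * qpochhammer (a * q / (b * C)) q k" for k
      by (simp add: mE qpochhammer_def prod.distrib)
    have pd: "(\<Prod>j<k. d j E) = qpochhammer (b * C * q) (q\<^sup>2) k * qpochhammer (a * q\<^sup>2 / C) (q\<^sup>2) k" for k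
      by (simp add: dE qpochhammer_def prod.distrib)
    have dnz: "d j E \<noteq> 0" for j
    proof -
      have "b * C * q * (q\<^sup>2) ^ j = a * q ^ (2 + 2 * i + 2 * j)"
        unfolding b' C_def c_def power_mult [of q 2, symmetric] using q(1)
        by (simp add: power_add power2_eq_square mult_ac)
      then have "b * C * q * (q\<^sup>2) ^ j \<noteq> 1"
        using a(2) by metis
      moreover have "a * q\<^sup>2 / C * (q\<^sup>2) ^ j = q ^ (2 + 2 * j) / q ^ (1 + 2 * s + 2 * i)"
        unfolding C_def c_def power_mult [of q 2, symmetric] using a(1) by (simp add: power_add power2_eq_square mult_ac)
      then have "a * q\<^sup>2 / C * (q\<^sup>2) ^ j \<noteq> 1"
        using odd_power_ratio_neq_1[OF q, of "2 + 2 * j" "1 + 2 * s + 2 * i"] by simp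
      ultimately show ?thesis
        by (simp add: dE)
    qed
    have pdnz: "(\<Prod>j<k. d j E) \<noteq> 0" for k
      using dnz by simp
    have "w k * (\<Prod>j<k. m j E) * (\<Prod>j=k..<K. d j E) = (\<Prod>j<K. d j E) * quadratic_term a b C q k"
      if "k \<le> K" for k
    proof -
      have "quadratic_term a b C q k = w k * (\<Prod>j<k. m j E) / (\<Prod>j<k. d j E)"
        unfolding pm pd quadratic_term_def w_def by (simp add: mult_ac)
      then show ?thesis
        unfolding prod_lessThan_split[OF that, of "\<lambda>j. d j E", symmetric]
        using pdnz[of k] by simp
    qed
    then have "(\<Sum>k\<le>K. w k * (\<Prod>j<k. m j E) * (\<Prod>j=k..<K. d j E))
       = (\<Prod>j<K. d j E) * (\<Sum>k\<le>K. quadratic_term a b C q k)"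
      by (simp add: sum_distrib_left)
    also have "(\<Sum>k\<le>K. quadratic_term a b C q k) = quadratic_value a b C q s"
      by (rule quadratic_sum_special[where j = i]) (use q a K b in \<open>auto simp: C_def c_def\<close>)
    also have "(\<Prod>j<K. d j E) * quadratic_value a b C q s
       = (1 - a) * qpochhammer (a * q\<^sup>2) (q\<^sup>2) s * qpochhammer (b * q) (q\<^sup>2) s * (\<Prod>j=s..<K. d j E)"
    proof -
      have "s \<le> K"
        using K by simp
      show ?thesis
        unfolding quadratic_value_def pd[symmetric] prod_lessThan_split[OF \<open>s \<le> K\<close>, of "\<lambda>j. d j E", symmetric]
        using pdnz[of s] by simp
    qed
    finally show ?thesis
      by (simp add: E_def C_def)
  qed
  define P where "P = (\<Sum>k\<le>K. [:w k:] * (\<Prod>j<k. [:1 + a * q / b * (q ^ j)\<^sup>2, - (q ^ j):])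
        * (\<Prod>j=k..<K. [:1 + a * b * q ^ 3 * ((q\<^sup>2) ^ j)\<^sup>2, - (b * q * (q\<^sup>2) ^ j):]))
     - [:(1 - a) * qpochhammer (a * q\<^sup>2) (q\<^sup>2) s * qpochhammer (b * q) (q\<^sup>2) s:]
       * (\<Prod>j=s..<K. [:1 + a * b * q ^ 3 * ((q\<^sup>2) ^ j)\<^sup>2, - (b * q * (q\<^sup>2) ^ j):])"
  have P: "poly P x = (\<Sum>k\<le>K. w k * (\<Prod>j<k. m j x) * (\<Prod>j=k..<K. d j x))
     - (1 - a) * qpochhammer (a * q\<^sup>2) (q\<^sup>2) s * qpochhammer (b * q) (q\<^sup>2) s * (\<Prod>j=s..<K. d j x)" for x
  proof -
    have m: "poly [:1 + a * q / b * (q ^ j)\<^sup>2, - (q ^ j):] x = m j x" for j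
      by (simp add: m_def algebra_simps)
    have d: "poly [:1 + a * b * q ^ 3 * ((q\<^sup>2) ^ j)\<^sup>2, - (b * q * (q\<^sup>2) ^ j):] x = d j x" for j
      by (simp add: d_def algebra_simps)
    show ?thesis
      unfolding P_def poly_diff poly_sum poly_mult poly_prod m d by simp
  qed
  have "P = 0"
  proof (rule ccontr)
    assume "P \<noteq> 0"
    then have "finite {x. poly P x = 0}"
      by (rule poly_roots_finite)
    moreover have "range (\<lambda>j. c j + A / c j) \<subseteq> {x. poly P x = 0}"
      using special by (auto simp: P)
    ultimately show False
      using inf finite_subset by blast
  qed
  then show ?thesis
    using P[of e] by simp
qed

section \<open>The one-parameter deformation of the sum\<close>

text \<open>
  If \<open>u + v + w = 3\<close>, \<open>u v + v w + w u = 3 + x\<close> and \<open>u v w = 1\<close>, then \<open>num_factor q x j\<close> is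
  \<open>(1 - u X) (1 - v X) (1 - w X)\<close> with \<open>X = q\<^bsup>2 j + 1\<^esup>\<close>, and the second factor of \<open>den_factor q x j\<close> is
  \<open>(1 - Y / u) (1 - Y / v) (1 - Y / w)\<close> with \<open>Y = q\<^bsup>4 j + 4\<^esup>\<close>. The case \<open>x = 0\<close> is the sum of the theorem,
  whose numerator over the common denominator \<open>sum_den M q x\<close> is \<open>sum_num M q x\<close>.
\<close>

definition sum_weight :: "'a::comm_ring_1 \<Rightarrow> nat \<Rightarrow> 'a" where
  "sum_weight q k = (1 - q ^ (6 * k + 1)) * qpochhammer q (q ^ 4) k * q ^ (k\<^sup>2 + k)"

definition num_factor :: "'a::comm_ring_1 \<Rightarrow> 'a \<Rightarrow> nat \<Rightarrow> 'a" where
  "num_factor q x j = (1 - q ^ (2 * j + 1)) ^ 3 + x * (q ^ (2 * j + 1))\<^sup>2"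

definition den_factor :: "'a::comm_ring_1 \<Rightarrow> 'a \<Rightarrow> nat \<Rightarrow> 'a" where
  "den_factor q x j = (1 - q ^ (2 * j + 2)) * ((1 - q ^ (4 * j + 4)) ^ 3 - x * q ^ (4 * j + 4))"

definition sum_den :: "nat \<Rightarrow> 'a::comm_ring_1 \<Rightarrow> 'a \<Rightarrow> 'a" where
  "sum_den M q x = (\<Prod>j<M. den_factor q x j)"

definition sum_num :: "nat \<Rightarrow> 'a::comm_ring_1 \<Rightarrow> 'a \<Rightarrow> 'a" where
  "sum_num M q x = (\<Sum>k\<le>M. sum_weight q k * (\<Prod>j<k. num_factor q x j) * (\<Prod>j=k..<M. den_factor q x j))"

lemma sum_num_eq:
  fixes q x :: "'a::field"
  assumes "\<And>j. j < M \<Longrightarrow> den_factor q x j \<noteq> 0"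
  shows "sum_num M q x = sum_den M q x * (\<Sum>k\<le>M. sum_weight q k * (\<Prod>j<k. num_factor q x j / den_factor q x j))"
proof -
  have "sum_weight q k * (\<Prod>j<k. num_factor q x j) * (\<Prod>j=k..<M. den_factor q x j)
     = sum_den M q x * (sum_weight q k * (\<Prod>j<k. num_factor q x j / den_factor q x j))" if "k \<le> M" for k
  proof -
    have "(\<Prod>j<k. den_factor q x j) \<noteq> 0"
      using assms that by auto
    then show ?thesis
      unfolding sum_den_def prod_lessThan_split[OF that, of "den_factor q x", symmetric] prod_dividef by simp
  qed
  then show ?thesis
    unfolding sum_num_def sum_distrib_left by (intro sum.cong) auto
qed

text \<open>\<open>sum_num\<close> and \<open>sum_den\<close> are polynomial expressions in q and x
  and so commute with ring homomorphisms. This moves them between complex numbers, polynomials in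
  one or two variables, and rational functions.\<close>

locale ring_homomorphism =
  fixes h :: "'a::comm_ring_1 \<Rightarrow> 'b::comm_ring_1"
  assumes hom_1: "h 1 = 1"
    and hom_add: "h (x + y) = h x + h y"
    and hom_mult: "h (x * y) = h x * h y"
begin

lemma hom_0: "h 0 = 0"
  using hom_add[of 0 0] by simp

lemma hom_diff: "h (x - y) = h x - h y"
  using hom_add[of "x - y" y] by (simp add: algebra_simps)

lemma hom_power: "h (x ^ n) = h x ^ n"
  by (induction n) (simp_all add: hom_1 hom_mult)

lemma hom_sum: "h (sum f A) = (\<Sum>i\<in>A. h (f i))"
  by (induction A rule: infinite_finite_induct) (simp_all add: hom_0 hom_add)

lemma hom_prod: "h (prod f A) = (\<Prod>i\<in>A. h (f i))"
  by (induction A rule: infinite_finite_induct) (simp_all add: hom_1 hom_mult)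

lemmas hom_simps = hom_0 hom_1 hom_add hom_diff hom_mult hom_power hom_sum hom_prod

lemma hom_sum_num: "h (sum_num M q x) = sum_num M (h q) (h x)"
  by (simp add: sum_num_def sum_weight_def qpochhammer_def num_factor_def den_factor_def hom_simps)

lemma hom_sum_den: "h (sum_den M q x) = sum_den M (h q) (h x)"
  by (simp add: sum_den_def den_factor_def hom_simps)

end

lemma ring_homomorphism_poly: "ring_homomorphism (\<lambda>p. poly p x)"
  by unfold_locales auto

lemma ring_homomorphism_poly_fract: "ring_homomorphism (\<lambda>p. poly (fract_poly p) x)"
  by unfold_locales auto

text \<open>One root of y^3 - 3 y^2 + (3 + x) y - 1 comes from algebraic closedness; the other two
  solve the quadratic with sum 3 - u and product 1 / u.\<close>

lemma obtain_unit_product_roots: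
  fixes x :: complex
  obtains u v w :: complex where "u + v + w = 3" "u * v + v * w + w * u = 3 + x" "u * v * w = 1"
proof -
  obtain u where u: "u ^ 3 - 3 * u\<^sup>2 + (3 + x) * u - 1 = 0"
  proof -
    have "\<not> constant (poly [:-1, 3 + x, -3, 1:])"
      by (simp add: constant_degree)
    from fundamental_theorem_of_algebra[OF this] show ?thesis
      using that by (auto simp: algebra_simps power2_eq_square power3_eq_cube)
  qed
  then have u0: "u \<noteq> 0"
    by auto
  define v where "v = ((3 - u) + csqrt ((3 - u)\<^sup>2 - 4 / u)) / 2"
  define w where "w = 3 - u - v"
  have "v * w = ((3 - u)\<^sup>2 - (csqrt ((3 - u)\<^sup>2 - 4 / u))\<^sup>2) / 4"
    unfolding w_def v_def by (simp add: field_simps power2_eq_square)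
  then have vw: "v * w = 1 / u"
    by simp
  have "u * v + v * w + w * u = u * (3 - u) + 1 / u"
    using vw by (simp add: w_def algebra_simps)
  also have "\<dots> = 3 + x"
    using u u0 by (simp add: field_simps power2_eq_square power3_eq_cube)
  finally show ?thesis
    using that[of u v w] vw u0 by (simp add: w_def mult.assoc)
qed

section \<open>Vanishing of the deformed sum at roots of unity\<close>

lemma sum_atMost_id: "q ^ (\<Sum>j\<le>k. j) * q ^ (\<Sum>j\<le>k. j) = (q::'a::comm_ring_1) ^ (k\<^sup>2 + k)"
  by (induction k) (simp_all add: power_add power2_eq_square mult_ac)

text \<open>The summation formula is applied in base q^2, where its triangular exponent becomes k^2
  + k.\<close>

lemma base_square_power: "(q\<^sup>2) ^ (\<Sum>j\<le>k. j) = (q::'a::comm_ring_1) ^ (k\<^sup>2 + k)"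
  using sum_atMost_id[of q k] by (simp add: power2_eq_square power_mult_distrib)

lemma prod_roots_num:
  fixes u v w :: "'a::field"
  assumes "u + v + w = 3" "u * v + v * w + w * u = 3 + x" "u * v * w = 1"
  shows "(1 - u * X) * (1 - v * X) * (1 - w * X) = (1 - X) ^ 3 + x * X\<^sup>2"
proof -
  have "(1 - u * X) * (1 - v * X) * (1 - w * X)
     = 1 - (u + v + w) * X + (u * v + v * w + w * u) * X\<^sup>2 - (u * v * w) * X ^ 3"
    by (simp add: algebra_simps power2_eq_square power3_eq_cube)
  then show ?thesis
    unfolding assms by (simp add: algebra_simps power2_eq_square power3_eq_cube)
qed

lemma prod_roots_den:
  fixes u v w :: "'a::field"
  assumes "u + v + w = 3" "u * v + v * w + w * u = 3 + x" "u * v * w = 1"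
  shows "(1 - Y / u) * (1 - Y / v) * (1 - Y / w) = (1 - Y) ^ 3 - x * Y"
proof -
  have nz: "u \<noteq> 0" "v \<noteq> 0" "w \<noteq> 0"
    using assms(3) by auto
  have "u * v * w * ((1 - Y / u) * (1 - Y / v) * (1 - Y / w))
     = u * v * w - (u * v + v * w + w * u) * Y + (u + v + w) * Y\<^sup>2 - Y ^ 3"
    using nz by (simp add: field_simps power2_eq_square power3_eq_cube)
  then show ?thesis
    unfolding assms by (simp add: algebra_simps power2_eq_square power3_eq_cube)
qed

lemma sum_weight_eq_0:
  assumes "q ^ (4 * j + 1) = 1" "j < k"
  shows "sum_weight q k = 0"
proof -
  have "qpochhammer q (q ^ 4) k = 0"
    using assms by (intro qpochhammer_zero[of j]) (simp_all flip: power_mult)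
  then show ?thesis
    by (simp add: sum_weight_def)
qed

text \<open>This is \<open>quadratic_sum_eq_0\<close> in base z^2 with a = z, b = z u, c = z v: the
  fourth parameter becomes z w because u v w = 1, and z^(4 m + 1) = 1 is the termination condition.
  By the last hypothesis no root of the cubic is a d-th root of unity, so \<open>u\<close>,
  \<open>v\<close>, \<open>w\<close> are not powers of z and no denominator vanishes.\<close>

lemma sum_num_root_of_unity_aux:
  fixes z x :: complex
  assumes d: "odd d" "z ^ d = 1" "\<And>i. 0 < i \<Longrightarrow> i < d \<Longrightarrow> z ^ i \<noteq> 1"
    and m: "z ^ (4 * m + 1) = 1" "m \<le> M" "M < d"
    and x: "\<And>u. u ^ d = 1 \<Longrightarrow> u ^ 3 - 3 * u\<^sup>2 + (3 + x) * u - 1 \<noteq> 0"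
  shows "sum_num M z x = 0"
proof -
  obtain u v w where uvw: "u + v + w = 3" "u * v + v * w + w * u = 3 + x" "u * v * w = 1"
    by (rule obtain_unit_product_roots)
  have nz: "u \<noteq> 0" "v \<noteq> 0" "w \<noteq> 0"
    using uvw(3) by auto
  have z0: "z \<noteq> 0"
    using d(1,2) by (metis odd_pos power_0_left zero_neq_one less_numeral_extra(3))
  have char: "y ^ 3 - 3 * y\<^sup>2 + (3 + x) * y - 1 = (y - u) * (y - v) * (y - w)" for y
  proof -
    have "(y - u) * (y - v) * (y - w) = y ^ 3 - (u + v + w) * y\<^sup>2 + (u * v + v * w + w * u) * y - u * v * w"
      by (simp add: algebra_simps power2_eq_square power3_eq_cube)
    then show ?thesis
      unfolding uvw by simp
  qed
  have ud: "u ^ d \<noteq> 1" "v ^ d \<noteq> 1" "w ^ d \<noteq> 1"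
    using x[of u] x[of v] x[of w] by (auto simp: char)
  have nroot: "z ^ i \<noteq> y" if "y ^ d \<noteq> 1" for i y
  proof
    assume "z ^ i = y"
    then have "y ^ d = (z ^ d) ^ i"
      by (metis power_mult mult.commute)
    then show False
      using that d(2) by simp
  qed
  \<comment> \<open>As d is odd, z^2 also has order d, and i \<le> M < d.\<close>
  have z2: "(z\<^sup>2) ^ i \<noteq> 1" if "0 < i" "i \<le> M" for i
  proof
    assume a: "(z\<^sup>2) ^ i = 1"
    show False
    proof (cases "2 * i < d")
      case True
      then show ?thesis
        using d(3)[of "2 * i"] that a by (simp add: power_mult)
    next
      case False
      then have "d < 2 * i"
        using d(1) by (cases "d = 2 * i") auto
      have "z ^ (2 * i - d) * z ^ d = z ^ (2 * i)"
        using \<open>d < 2 * i\<close> by (simp flip: power_add)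
      then show ?thesis
        using d(2) d(3)[of "2 * i - d"] that a m(3) \<open>d < 2 * i\<close> by (simp add: power_mult)
    qed
  qed
  have pw: "(z\<^sup>2)\<^sup>2 = z ^ 4" "(z ^ 4) ^ j = z ^ (4 * j)" "(z\<^sup>2) ^ j = z ^ (2 * j)" for j
    by (simp_all flip: power_mult)
  have eqb: "z * (z\<^sup>2)\<^sup>2 / (z * y) * ((z\<^sup>2)\<^sup>2) ^ j = z ^ (4 * j + 4) / y" if "y \<noteq> 0" for y j
    using that z0 unfolding pw(1) pw(2) power_add by (simp add: mult.commute)
  have eqbc: "z * u * (z * v) * z\<^sup>2 * ((z\<^sup>2)\<^sup>2) ^ j = z ^ (4 * j + 4) / w" for j
  proof -
    have "u * v = 1 / w"
      using uvw(3) nz by (simp add: field_simps)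
    moreover have "z * u * (z * v) * z\<^sup>2 = (u * v) * z ^ 4"
      by (simp add: power2_eq_square power4_eq_xxxx)
    then have "z * u * (z * v) * z\<^sup>2 * ((z\<^sup>2)\<^sup>2) ^ j = (u * v) * z ^ (4 * j + 4)"
      unfolding pw(1) pw(2) power_add by (simp only: mult_ac)
    ultimately show ?thesis
      by simp
  qed
  have neq: "z ^ i / y \<noteq> 1" if "y ^ d \<noteq> 1" for i y
    using nroot[OF that, of i] by (metis div_by_0 divide_eq_1_iff zero_neq_one)
  have "(\<Sum>k\<le>m. quadratic_term z (z * u) (z * v) (z\<^sup>2) k) = 0"
  proof (rule quadratic_sum_eq_0)
    show "z * ((z\<^sup>2)\<^sup>2) ^ m = 1"
      using m(1) unfolding pw(1) pw(2) by simp
    show "(z\<^sup>2) ^ j \<noteq> 1" if "0 < j" "j \<le> m" for j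
      using z2 that m(2) by simp
    show "z * (z\<^sup>2)\<^sup>2 / (z * u) * ((z\<^sup>2)\<^sup>2) ^ j \<noteq> 1"
      "z * (z\<^sup>2)\<^sup>2 / (z * v) * ((z\<^sup>2)\<^sup>2) ^ j \<noteq> 1"
      "z * u * (z * v) * z\<^sup>2 * ((z\<^sup>2)\<^sup>2) ^ j \<noteq> 1" for j
      unfolding eqb[OF nz(1)] eqb[OF nz(2)] eqbc using neq ud by blast+
  qed (use nz z0 in auto)
  moreover have "quadratic_term z (z * u) (z * v) (z\<^sup>2) k
     = sum_weight z k * (\<Prod>j<k. num_factor z x j / den_factor z x j)" for k
  proof -
    have C: "z * z\<^sup>2 / (z * u * (z * v)) = z * w"
      using uvw(3) nz z0 by (simp add: field_simps power2_eq_square)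
    have n: "qpochhammer (z * u) (z\<^sup>2) k * qpochhammer (z * v) (z\<^sup>2) k * qpochhammer (z * w) (z\<^sup>2) k
        = (\<Prod>j<k. num_factor z x j)"
      unfolding qpochhammer_def prod.distrib[symmetric] num_factor_def
        prod_roots_num[OF uvw, symmetric] pw(3) by (simp add: mult_ac)
    have dd: "qpochhammer (z\<^sup>2) (z\<^sup>2) k * qpochhammer (z * (z\<^sup>2)\<^sup>2 / (z * u)) ((z\<^sup>2)\<^sup>2) k
      * qpochhammer (z * (z\<^sup>2)\<^sup>2 / (z * v)) ((z\<^sup>2)\<^sup>2) k
      * qpochhammer (z * u * (z * v) * z\<^sup>2) ((z\<^sup>2)\<^sup>2) k
        = (\<Prod>j<k. den_factor z x j)"
      unfolding qpochhammer_def eqb[OF nz(1)] eqb[OF nz(2)] eqbc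
      unfolding prod.distrib[symmetric] den_factor_def
        prod_roots_den[OF uvw, symmetric] pw(3) by (simp add: mult_ac power2_eq_square)
    have e: "1 - z * (z\<^sup>2) ^ (3 * k) = 1 - z ^ (6 * k + 1)"
      unfolding pw(3) by simp
    have "quadratic_term z (z * u) (z * v) (z\<^sup>2) k = (1 - z * (z\<^sup>2) ^ (3 * k)) * qpochhammer z ((z\<^sup>2)\<^sup>2) k
       * (qpochhammer (z * u) (z\<^sup>2) k * qpochhammer (z * v) (z\<^sup>2) k * qpochhammer (z * w) (z\<^sup>2) k)
       / (qpochhammer (z\<^sup>2) (z\<^sup>2) k * qpochhammer (z * (z\<^sup>2)\<^sup>2 / (z * u)) ((z\<^sup>2)\<^sup>2) k
          * qpochhammer (z * (z\<^sup>2)\<^sup>2 / (z * v)) ((z\<^sup>2)\<^sup>2) k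
          * qpochhammer (z * u * (z * v) * z\<^sup>2) ((z\<^sup>2)\<^sup>2) k) * (z\<^sup>2) ^ (\<Sum>j\<le>k. j)"
      unfolding quadratic_term_def C by (simp only: mult.assoc)
    also have "\<dots> = sum_weight z k * ((\<Prod>j<k. num_factor z x j) / (\<Prod>j<k. den_factor z x j))"
      unfolding dd n e base_square_power sum_weight_def unfolding pw(1) by simp
    finally show ?thesis
      unfolding prod_dividef .
  qed
  ultimately have "(\<Sum>k\<le>m. sum_weight z k * (\<Prod>j<k. num_factor z x j / den_factor z x j)) = 0"
    by simp
  \<comment> \<open>Beyond m the factor 1 - z^(4 m + 1) of (z; z^4)_k is zero.\<close>
  also have "(\<Sum>k\<le>m. sum_weight z k * (\<Prod>j<k. num_factor z x j / den_factor z x j))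
     = (\<Sum>k\<le>M. sum_weight z k * (\<Prod>j<k. num_factor z x j / den_factor z x j))"
    using m(2) sum_weight_eq_0[OF m(1)] by (intro sum.mono_neutral_left) auto
  finally have S: "(\<Sum>k\<le>M. sum_weight z k * (\<Prod>j<k. num_factor z x j / den_factor z x j)) = 0" .
  have "den_factor z x j \<noteq> 0" if "j < M" for j
  proof -
    have "z ^ (2 * j + 2) \<noteq> 1"
      using z2[of "Suc j"] that by (simp add: power_mult[symmetric] del: power_Suc)
    then show ?thesis
      using nroot[OF ud(1)] nroot[OF ud(2)] nroot[OF ud(3)] nz
      unfolding den_factor_def prod_roots_den[OF uvw, symmetric] by simp
  qed
  then show ?thesis
    using S by (subst sum_num_eq) auto
qed

text \<open>The values of x not covered so far form the finite set \<open>B\<close>, found by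
  solving the cubic for x at each d-th root of unity. A polynomial in x that vanishes at all other
  points is zero.\<close>

lemma sum_num_root_of_unity:
  fixes z x :: complex
  assumes d: "odd d" "z ^ d = 1" "\<And>i. 0 < i \<Longrightarrow> i < d \<Longrightarrow> z ^ i \<noteq> 1"
    and m: "z ^ (4 * m + 1) = 1" "m \<le> M" "M < d"
  shows "sum_num M z x = 0"
proof -
  define P where "P = sum_num M [:z:] [:0, 1:]"
  interpret h: ring_homomorphism "\<lambda>p. poly p y" for y :: complex
    by (rule ring_homomorphism_poly)
  have P: "poly P x = sum_num M z x" for x
    by (simp add: P_def h.hom_sum_num)
  define B where "B = (\<lambda>u::complex. (1 + 3 * u\<^sup>2 - u ^ 3) / u - 3) ` {u. u ^ d = 1}"
  have "finite B"
    unfolding B_def using d(1) by (intro finite_imageI finite_roots_unity) (simp add: Suc_le_eq odd_pos)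
  have "sum_num M z x = 0" if "x \<notin> B" for x
  proof (rule sum_num_root_of_unity_aux[OF d m])
    fix u :: complex
    assume u: "u ^ d = 1"
    then have u0: "u \<noteq> 0"
      using d(1) by (metis odd_pos power_0_left zero_neq_one less_numeral_extra(3))
    show "u ^ 3 - 3 * u\<^sup>2 + (3 + x) * u - 1 \<noteq> 0"
    proof
      assume "u ^ 3 - 3 * u\<^sup>2 + (3 + x) * u - 1 = 0"
      then have "x = (1 + 3 * u\<^sup>2 - u ^ 3) / u - 3"
        using u0 by (simp add: field_simps)
      then show False
        using that u by (auto simp: B_def)
    qed
  qed
  then have "- B \<subseteq> {x. poly P x = 0}"
    by (auto simp: P)
  moreover have "infinite (- B)"
    using \<open>finite B\<close> by (simp add: infinite_UNIV_char_0)
  ultimately have "P = 0"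
    using poly_roots_finite[of P] finite_subset by blast
  then show ?thesis
    using P[of x] by simp
qed

section \<open>Closed form of the deformed sum for u = q^(-n)\<close>

lemma prod_power_arith: "(\<Prod>j<m. (q::'a::comm_ring_1) ^ (8 * j + 6)) = q ^ (4 * m * m + 2 * m)"
proof (induction m)
  case (Suc m)
  have "4 * m * m + 2 * m + (8 * m + 6) = 4 * Suc m * Suc m + 2 * Suc m"
    by (simp add: algebra_simps)
  then show ?case
    using Suc by (simp only: prod.lessThan_Suc power_add [symmetric])
qed simp

text \<open>The left factorials are read backwards: u q^(4 m + 1) = 1 makes
  \<open>A (m - Suc j)\<close> inverse to \<open>A' j\<close> and \<open>B (m - Suc j)\<close>
  inverse to \<open>B' j\<close>, and (1 - A) A' = A' - 1. The two signs cancel, and the product of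
  all \<open>A' j * B' j\<close> is q^m.\<close>

lemma qpochhammer_reflect:
  fixes q u :: "'a::field"
  assumes u: "u * q ^ (4 * m + 1) = 1"
  shows "qpochhammer q (q ^ 4) m * qpochhammer (q ^ 3 * u) (q ^ 4) m * q ^ m
    = qpochhammer (q\<^sup>2) (q ^ 4) m * (\<Prod>j<m. 1 - u * q ^ (4 * j + 4))"
proof -
  have pw: "(q ^ 4) ^ j = q ^ (4 * j)" for j
    by (simp flip: power_mult)
  define A B where "A i = q * (q ^ 4) ^ i" and "B i = q ^ 3 * u * (q ^ 4) ^ i" for i
  define A' B' where "A' i = u * q ^ (4 * i + 4)" and "B' i = q\<^sup>2 * (q ^ 4) ^ i" for i
  have step: "(1 - A (m - Suc j)) * (1 - B (m - Suc j)) * (A' j * B' j) = (1 - B' j) * (1 - A' j)" if "j < m" for j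
  proof -
    have e: "1 + 4 * (m - Suc j) + (4 * j + 4) = 4 * m + 1" "3 + 4 * (m - Suc j) + (2 + 4 * j) = 4 * m + 1"
      using that by auto
    have p: "A (m - Suc j) * A' j = u * q ^ (1 + 4 * (m - Suc j) + (4 * j + 4))"
       "B (m - Suc j) * B' j = u * q ^ (3 + 4 * (m - Suc j) + (2 + 4 * j))"
      unfolding A_def A'_def B_def B'_def pw power_add power_one_right by (simp_all only: mult_ac)
    have "A (m - Suc j) * A' j = 1" "B (m - Suc j) * B' j = 1"
      unfolding p e by (rule u)+
    moreover have "(1 - a) * (1 - b) * (a' * b') = (a' - a * a') * (b' - b * b')" for a b a' b' :: 'a
      by (simp add: algebra_simps)
    ultimately show ?thesis
      by (simp add: algebra_simps)
  qed
  have um: "u ^ m * q ^ ((4 * m + 1) * m) = 1"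
    by (metis u power_mult power_mult_distrib power_one)
  have "A' j * B' j = u * q ^ (8 * j + 6)" for j
  proof -
    have "A' j * B' j = u * q ^ (4 * j + 4 + (2 + 4 * j))"
      unfolding A'_def B'_def pw power_add by (simp only: mult.assoc)
    also have "4 * j + 4 + (2 + 4 * j) = 8 * j + 6"
      by simp
    finally show ?thesis .
  qed
  then have "(\<Prod>j<m. A' j * B' j) = (\<Prod>j<m. u * q ^ (8 * j + 6))"
    by simp
  also have "\<dots> = u ^ m * q ^ (4 * m * m + 2 * m)"
    by (simp add: prod.distrib prod_power_arith)
  also have "4 * m * m + 2 * m = (4 * m + 1) * m + m"
    by (simp add: algebra_simps)
  also have "u ^ m * q ^ \<dots> = q ^ m"
    unfolding power_add mult.assoc [symmetric] um by simp
  finally have AB: "(\<Prod>j<m. A' j * B' j) = q ^ m" .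
  have "qpochhammer q (q ^ 4) m * qpochhammer (q ^ 3 * u) (q ^ 4) m = (\<Prod>j<m. (1 - A j) * (1 - B j))"
    by (simp add: qpochhammer_def A_def B_def prod.distrib)
  also have "\<dots> = (\<Prod>j<m. (1 - A (m - Suc j)) * (1 - B (m - Suc j)))"
    by (rule prod.nat_diff_reindex [symmetric])
  finally have "qpochhammer q (q ^ 4) m * qpochhammer (q ^ 3 * u) (q ^ 4) m * q ^ m
     = (\<Prod>j<m. (1 - A (m - Suc j)) * (1 - B (m - Suc j)) * (A' j * B' j))"
    by (simp only: AB [symmetric] prod.distrib [symmetric])
  also have "\<dots> = (\<Prod>j<m. (1 - B' j) * (1 - A' j))"
    using step by (intro prod.cong) auto
  also have "\<dots> = qpochhammer (q\<^sup>2) (q ^ 4) m * (\<Prod>j<m. 1 - u * q ^ (4 * j + 4))"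
    unfolding qpochhammer_def A'_def B'_def by (simp add: prod.distrib)
  finally show ?thesis .
qed

text \<open>This is \<open>quadratic_sum_symmetric\<close> in base q^2 with a = q, b = q u, s = m
  and e = q (v + w) = q (3 - u). As u is a root of the cubic, its linear factors split off from
  \<open>num_factor\<close> and \<open>den_factor\<close>, and the rest involves only v + w = 3 - u
  and v w = 1 / u. \<open>qpochhammer_reflect\<close> brings the result into its final form.\<close>

lemma sum_num_closed_form:
  fixes q u x :: "'a::field"
  assumes q: "q \<noteq> 0" "\<And>i. 0 < i \<Longrightarrow> q ^ i \<noteq> 1"
    and u: "u * q ^ (4 * m + 1) = 1" and x: "x = (1 - u) ^ 3 / u" and M: "2 * m \<le> M"
  shows "sum_num M q x * (\<Prod>j<m. (1 - q ^ (4 * j + 4)) ^ 3 - x * q ^ (4 * j + 4)) * q ^ m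
     = sum_den M q x * (1 - q ^ (4 * m + 1)) * qpochhammer (q\<^sup>2) (q ^ 4) m
       * (\<Prod>j<m. (1 - u * q ^ (4 * j + 4)) * (1 - q ^ (4 * j + 4) / u))"
proof -
  have u0: "u \<noteq> 0"
    using u by auto
  have pw1: "(q\<^sup>2)\<^sup>2 = q ^ 4" and pw2: "(q\<^sup>2) ^ j = q ^ (2 * j)" and pw3: "(q ^ 4) ^ j = q ^ (4 * j)" for j
    by (simp_all flip: power_mult)
  have xu: "3 + x = u * (3 - u) + 1 / u"
    using u0 unfolding x by (simp add: field_simps power2_eq_square power3_eq_cube)
  define X Y where "X j = q ^ (2 * j + 1)" and "Y j = q ^ (4 * j + 4)" for j
  \<comment> \<open>\<open>mm j\<close> is (1 - v X) (1 - w X) and \<open>dd j\<close> is (1 - Y /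
    v) (1 - Y / w), written without the roots v and w.\<close>
  define mm dd where "mm j = 1 - (3 - u) * X j + (X j)\<^sup>2 / u" and "dd j = 1 - (3 - u) * u * Y j + u * (Y j)\<^sup>2" for j
  define c where "c j = (1 - q ^ (2 * j + 2)) * (1 - Y j / u)" for j
  have num: "num_factor q x j = (1 - u * X j) * mm j" for j
  proof -
    have "(1 - u * y) * (1 - (3 - u) * y + y\<^sup>2 / u) = (1 - y) ^ 3 + (u * (3 - u) + 1 / u - 3) * y\<^sup>2" for y
      using u0 by (simp add: field_simps power2_eq_square power3_eq_cube)
    then show ?thesis
      unfolding num_factor_def X_def [symmetric] mm_def xu [symmetric] by simp
  qed
  have den': "(1 - Y j) ^ 3 - x * Y j = (1 - Y j / u) * dd j" for j
  proof -
    have "(1 - y / u) * (1 - (3 - u) * u * y + u * y\<^sup>2) = (1 - y) ^ 3 - (u * (3 - u) + 1 / u - 3) * y" for y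
      using u0 by (simp add: field_simps power2_eq_square power3_eq_cube)
    then show ?thesis
      unfolding dd_def xu [symmetric] by simp
  qed
  have den: "den_factor q x j = c j * dd j" for j
    unfolding den_factor_def Y_def [symmetric] den' c_def by simp
  define w where "w k = (1 - q * (q\<^sup>2) ^ (3 * k)) * qpochhammer q ((q\<^sup>2)\<^sup>2) k * qpochhammer (q * u) (q\<^sup>2) k * (q\<^sup>2) ^ (\<Sum>j\<le>k. j)
        / (qpochhammer (q\<^sup>2) (q\<^sup>2) k * qpochhammer (q * (q\<^sup>2)\<^sup>2 / (q * u)) ((q\<^sup>2)\<^sup>2) k)" for k
  have mm: "1 - q * (3 - u) * (q\<^sup>2) ^ j + q * q\<^sup>2 / (q * u) * ((q\<^sup>2) ^ j)\<^sup>2 = mm j" for j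
  proof -
    have "(X j)\<^sup>2 = q\<^sup>2 * ((q\<^sup>2) ^ j)\<^sup>2"
      unfolding X_def pw2 power_add by (simp add: power2_eq_square)
    then show ?thesis
      unfolding mm_def using q(1) by (simp add: X_def pw2 mult_ac)
  qed
  have dd: "1 - q * (3 - u) * (q * u) * q\<^sup>2 * ((q\<^sup>2)\<^sup>2) ^ j + q * (q * u) * (q\<^sup>2) ^ 3 * (((q\<^sup>2)\<^sup>2) ^ j)\<^sup>2 = dd j" for j
  proof -
    have Y: "Y j = q * q * q * q * ((q\<^sup>2)\<^sup>2) ^ j"
      unfolding Y_def pw1 pw3 power_add by (simp add: power4_eq_xxxx)
    show ?thesis
      unfolding dd_def Y by (simp add: power2_eq_square power3_eq_cube mult_ac)
  qed
  have S: "(\<Sum>k\<le>M. w k * (\<Prod>j<k. mm j) * (\<Prod>j=k..<M. dd j))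
     = (1 - q) * qpochhammer (q * (q\<^sup>2)\<^sup>2) ((q\<^sup>2)\<^sup>2) m * qpochhammer (q * u * q\<^sup>2) ((q\<^sup>2)\<^sup>2) m * (\<Prod>j=m..<M. dd j)"
  proof -
    have "(q\<^sup>2) ^ i \<noteq> 1" if "0 < i" for i
      using q(2)[of "2 * i"] that by (simp add: pw2)
    moreover have "q * (q\<^sup>2) ^ i \<noteq> 1" for i
      using q(2)[of "2 * i + 1"] by (simp add: pw2)
    moreover have "q * u * (q\<^sup>2) ^ (2 * m) = 1"
      using u by (simp add: pw2 mult_ac)
    ultimately show ?thesis
      unfolding w_def mm [symmetric] dd [symmetric]
      using q(1) M by (intro quadratic_sum_symmetric) auto
  qed
  have c0: "c j \<noteq> 0" for j
  proof -
    have "Y j / u = Y j * q ^ (4 * m + 1)"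
      using u u0 by (simp add: field_simps)
    also have "\<dots> = q ^ (4 * j + 4 + (4 * m + 1))"
      unfolding Y_def power_add ..
    finally show ?thesis
      using q(2)[of "4 * j + 4 + (4 * m + 1)"] q(2)[of "2 * j + 2"] unfolding c_def by auto
  qed
  have "sum_num M q x = (\<Prod>j<M. c j) * (\<Sum>k\<le>M. w k * (\<Prod>j<k. mm j) * (\<Prod>j=k..<M. dd j))"
    unfolding sum_num_def sum_distrib_left
  proof (intro sum.cong refl)
    fix k
    assume "k \<in> {..M}"
    then have k: "k \<le> M"
      by simp
    have "q * (q\<^sup>2)\<^sup>2 / (q * u) = q ^ 4 / u"
      using q(1) unfolding pw1 by simp
    moreover have "(\<Prod>j<k. c j) = qpochhammer (q\<^sup>2) (q\<^sup>2) k * qpochhammer (q ^ 4 / u) (q ^ 4) k"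
      unfolding qpochhammer_def c_def Y_def pw2 pw3 power_add prod.distrib
      by (simp add: mult_ac)
    moreover have "1 - q * (q\<^sup>2) ^ (3 * k) = 1 - q ^ (6 * k + 1)"
      unfolding pw2 by simp
    ultimately have w: "w k = sum_weight q k * qpochhammer (q * u) (q\<^sup>2) k / (\<Prod>j<k. c j)"
      unfolding w_def sum_weight_def base_square_power by (simp add: pw1)
    have "(\<Prod>j<k. num_factor q x j) = qpochhammer (q * u) (q\<^sup>2) k * (\<Prod>j<k. mm j)"
      unfolding num prod.distrib qpochhammer_def X_def pw2 by (simp add: mult_ac)
    moreover have "(\<Prod>j<k. c j) \<noteq> 0"
      using c0 by simp
    ultimately show "sum_weight q k * (\<Prod>j<k. num_factor q x j) * (\<Prod>j=k..<M. den_factor q x j)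
       = (\<Prod>j<M. c j) * (w k * (\<Prod>j<k. mm j) * (\<Prod>j=k..<M. dd j))"
      unfolding w den prod.distrib prod_lessThan_split[OF k, of c, symmetric] by simp
  qed
  also have "(1 - q) * qpochhammer (q * (q\<^sup>2)\<^sup>2) ((q\<^sup>2)\<^sup>2) m = qpochhammer q (q ^ 4) m * (1 - q ^ (4 * m + 1))"
    using qpochhammer_Suc[of q "q ^ 4" m] qpochhammer_Suc'[of q "q ^ 4" m] unfolding pw1 pw3 by simp
  note S [unfolded this]
  also have "q * u * q\<^sup>2 = q ^ 3 * u"
    by (simp add: power2_eq_square power3_eq_cube)
  finally have N: "sum_num M q x = (\<Prod>j<M. c j) * (qpochhammer q (q ^ 4) m * (1 - q ^ (4 * m + 1))
      * qpochhammer (q ^ 3 * u) (q ^ 4) m * (\<Prod>j=m..<M. dd j))"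
    unfolding pw1 .
  have "m \<le> M"
    using M by simp
  have "sum_num M q x * (\<Prod>j<m. (1 - Y j) ^ 3 - x * Y j) * q ^ m
     = (\<Prod>j<M. c j) * ((\<Prod>j<m. dd j) * (\<Prod>j=m..<M. dd j)) * (1 - q ^ (4 * m + 1))
       * (qpochhammer q (q ^ 4) m * qpochhammer (q ^ 3 * u) (q ^ 4) m * q ^ m) * (\<Prod>j<m. 1 - Y j / u)"
    unfolding N den' prod.distrib by (simp only: mult_ac)
  also have "\<dots> = sum_den M q x * (1 - q ^ (4 * m + 1)) * qpochhammer (q\<^sup>2) (q ^ 4) m
       * (\<Prod>j<m. (1 - u * Y j) * (1 - Y j / u))"
    unfolding qpochhammer_reflect[OF u] prod_lessThan_split[OF \<open>m \<le> M\<close>] sum_den_def den prod.distrib Y_def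
    by (simp only: mult_ac)
  finally show ?thesis
    unfolding Y_def .
qed

section \<open>Rational functions near a point\<close>

text \<open>\<open>regular_at\<close>, \<open>unit_at\<close> and \<open>vanishes_at\<close>
  describe the local ring of rational functions at \<open>z\<close>, its units and the e-th power of
  its maximal ideal. Membership serves as a lower bound for the order, so the zero function needs no
  separate case.\<close>

definition regular_at :: "complex \<Rightarrow> complex poly fract \<Rightarrow> bool" where
  "regular_at z A \<longleftrightarrow> (\<exists>a b. A = to_fract a / to_fract b \<and> poly b z \<noteq> 0)"

definition unit_at :: "complex \<Rightarrow> complex poly fract \<Rightarrow> bool" where
  "unit_at z A \<longleftrightarrow> (\<exists>a b. A = to_fract a / to_fract b \<and> poly a z \<noteq> 0 \<and> poly b z \<noteq> 0)"

definition vanishes_at :: "complex \<Rightarrow> nat \<Rightarrow> complex poly fract \<Rightarrow> bool" where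
  "vanishes_at z e A \<longleftrightarrow> (\<exists>C. regular_at z C \<and> A = to_fract [:- z, 1:] ^ e * C)"

lemma to_fract_power: "to_fract (p ^ n) = to_fract p ^ n"
  by (induction n) simp_all

lemma regular_at_to_fract: "regular_at z (to_fract p)"
  unfolding regular_at_def by (rule exI[of _ p], rule exI[of _ 1]) simp

lemma unit_at_to_fract: "poly p z \<noteq> 0 \<Longrightarrow> unit_at z (to_fract p)"
  unfolding unit_at_def by (rule exI[of _ p], rule exI[of _ 1]) simp

lemma unit_at_imp_regular_at: "unit_at z A \<Longrightarrow> regular_at z A"
  unfolding unit_at_def regular_at_def by auto

lemma unit_at_nonzero: "unit_at z A \<Longrightarrow> A \<noteq> 0"
  unfolding unit_at_def by auto

lemma regular_at_0: "regular_at z 0" and regular_at_1: "regular_at z 1"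
  using regular_at_to_fract[of z 0] regular_at_to_fract[of z 1] by simp_all

lemma regular_at_mult:
  assumes "regular_at z A" "regular_at z B"
  shows "regular_at z (A * B)"
proof -
  obtain a b c d where "A = to_fract a / to_fract b" "poly b z \<noteq> 0" "B = to_fract c / to_fract d" "poly d z \<noteq> 0"
    using assms unfolding regular_at_def by blast
  then show ?thesis
    unfolding regular_at_def by (intro exI[of _ "a * c"] exI[of _ "b * d"]) simp
qed

lemma regular_at_add:
  assumes "regular_at z A" "regular_at z B"
  shows "regular_at z (A + B)"
proof -
  obtain a b c d where *: "A = to_fract a / to_fract b" "poly b z \<noteq> 0" "B = to_fract c / to_fract d" "poly d z \<noteq> 0"
    using assms unfolding regular_at_def by blast
  then have "b \<noteq> 0" "d \<noteq> 0"
    by auto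
  then show ?thesis
    unfolding regular_at_def using * 
    by (intro exI[of _ "a * d + c * b"] exI[of _ "b * d"]) (simp add: field_simps)
qed

lemma regular_at_uminus: "regular_at z A \<Longrightarrow> regular_at z (- A)"
  using regular_at_mult[OF regular_at_to_fract[of z "- 1"]] by fastforce

lemma regular_at_diff: "regular_at z A \<Longrightarrow> regular_at z B \<Longrightarrow> regular_at z (A - B)"
  using regular_at_add[OF _ regular_at_uminus] by fastforce

lemma regular_at_power: "regular_at z A \<Longrightarrow> regular_at z (A ^ n)"
  by (induction n) (simp_all add: regular_at_1 regular_at_mult)

lemma regular_at_sum: "(\<And>i. i \<in> I \<Longrightarrow> regular_at z (f i)) \<Longrightarrow> regular_at z (sum f I)"
  by (induction I rule: infinite_finite_induct) (simp_all add: regular_at_0 regular_at_add)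

lemma regular_at_prod: "(\<And>i. i \<in> I \<Longrightarrow> regular_at z (f i)) \<Longrightarrow> regular_at z (prod f I)"
  by (induction I rule: infinite_finite_induct) (simp_all add: regular_at_1 regular_at_mult)

lemma unit_at_1: "unit_at z 1"
  using unit_at_to_fract[of 1 z] by simp

lemma unit_at_mult:
  assumes "unit_at z A" "unit_at z B"
  shows "unit_at z (A * B)"
proof -
  obtain a b c d where "A = to_fract a / to_fract b" "poly a z \<noteq> 0" "poly b z \<noteq> 0"
     "B = to_fract c / to_fract d" "poly c z \<noteq> 0" "poly d z \<noteq> 0"
    using assms unfolding unit_at_def by blast
  then show ?thesis
    unfolding unit_at_def by (intro exI[of _ "a * c"] exI[of _ "b * d"]) simp
qed

lemma unit_at_inverse: "unit_at z A \<Longrightarrow> unit_at z (inverse A)"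
  unfolding unit_at_def by (metis inverse_divide)

lemma unit_at_power: "unit_at z A \<Longrightarrow> unit_at z (A ^ n)"
  by (induction n) (simp_all add: unit_at_1 unit_at_mult)

lemma unit_at_prod: "(\<And>i. i \<in> I \<Longrightarrow> unit_at z (f i)) \<Longrightarrow> unit_at z (prod f I)"
  by (induction I rule: infinite_finite_induct) (simp_all add: unit_at_1 unit_at_mult)

lemma regular_at_divide: "regular_at z A \<Longrightarrow> unit_at z B \<Longrightarrow> regular_at z (A / B)"
  unfolding divide_inverse by (rule regular_at_mult[OF _ unit_at_imp_regular_at[OF unit_at_inverse]])

lemma vanishes_at_0_iff: "vanishes_at z 0 A \<longleftrightarrow> regular_at z A"
  by (simp add: vanishes_at_def)

lemma vanishes_at_mono:
  assumes "vanishes_at z e A" "e' \<le> e"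
  shows "vanishes_at z e' A"
proof -
  obtain C where C: "regular_at z C" "A = to_fract [:- z, 1:] ^ e * C"
    using assms(1) unfolding vanishes_at_def by blast
  have "e = e' + (e - e')"
    using assms(2) by simp
  then have "A = to_fract [:- z, 1:] ^ e' * (to_fract [:- z, 1:] ^ (e - e') * C)"
    using C(2) by (metis power_add mult.assoc)
  then show ?thesis
    unfolding vanishes_at_def
    by (intro exI conjI) (rule regular_at_mult[OF regular_at_power[OF regular_at_to_fract] C(1)])
qed

lemma vanishes_at_regular: "vanishes_at z e A \<Longrightarrow> regular_at z A"
  using vanishes_at_mono[of z e A 0] by (simp add: vanishes_at_0_iff)

lemma vanishes_at_0: "vanishes_at z e 0"
  unfolding vanishes_at_def by (rule exI[of _ 0]) (simp add: regular_at_0)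

lemma vanishes_at_add: "vanishes_at z e A \<Longrightarrow> vanishes_at z e B \<Longrightarrow> vanishes_at z e (A + B)"
  unfolding vanishes_at_def by (metis distrib_left regular_at_add)

lemma vanishes_at_uminus: "vanishes_at z e A \<Longrightarrow> vanishes_at z e (- A)"
  unfolding vanishes_at_def by (metis mult_minus_right regular_at_uminus)

lemma vanishes_at_diff: "vanishes_at z e A \<Longrightarrow> vanishes_at z e B \<Longrightarrow> vanishes_at z e (A - B)"
  unfolding vanishes_at_def by (metis right_diff_distrib regular_at_diff)

lemma vanishes_at_mult:
  assumes "vanishes_at z e A" "vanishes_at z e' B"
  shows "vanishes_at z (e + e') (A * B)"
proof -
  obtain C D where "regular_at z C" "A = to_fract [:- z, 1:] ^ e * C" 
    "regular_at z D" "B = to_fract [:- z, 1:] ^ e' * D"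
    using assms unfolding vanishes_at_def by blast
  then show ?thesis
    unfolding vanishes_at_def by (intro exI[of _ "C * D"]) (simp add: regular_at_mult power_add mult_ac)
qed

lemma vanishes_at_mult_left: "vanishes_at z e A \<Longrightarrow> regular_at z B \<Longrightarrow> vanishes_at z e (A * B)"
  using vanishes_at_mult[of z e A 0 B] by (simp add: vanishes_at_0_iff)

lemma vanishes_at_mult_right: "regular_at z A \<Longrightarrow> vanishes_at z e B \<Longrightarrow> vanishes_at z e (A * B)"
  using vanishes_at_mult_left[of z e B A] by (simp add: mult.commute)

lemma vanishes_at_power: "vanishes_at z e A \<Longrightarrow> vanishes_at z (n * e) (A ^ n)"
  by (induction n) (simp_all add: vanishes_at_0_iff regular_at_1 vanishes_at_mult)

lemma vanishes_at_sum: "(\<And>i. i \<in> I \<Longrightarrow> vanishes_at z e (f i)) \<Longrightarrow> vanishes_at z e (sum f I)"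
  by (induction I rule: infinite_finite_induct) (simp_all add: vanishes_at_0 vanishes_at_add)

lemma vanishes_at_divide: "vanishes_at z e A \<Longrightarrow> unit_at z B \<Longrightarrow> vanishes_at z e (A / B)"
  unfolding divide_inverse by (rule vanishes_at_mult_left[OF _ unit_at_imp_regular_at[OF unit_at_inverse]])

lemma vanishes_at_prod:
  assumes "finite I" "i \<in> I" "vanishes_at z e (f i)" "\<And>j. j \<in> I \<Longrightarrow> regular_at z (f j)"
  shows "vanishes_at z e (prod f I)"
  unfolding prod.remove[OF assms(1,2)]
  using assms by (intro vanishes_at_mult_left regular_at_prod) auto

lemma vanishes_at_to_fract:
  assumes "poly p z = 0"
  shows "vanishes_at z 1 (to_fract p)"
proof -
  obtain r where "p = [:- z, 1:] * r"
    using assms unfolding poly_eq_0_iff_dvd by blast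
  then show ?thesis
    unfolding vanishes_at_def by (intro exI[of _ "to_fract r"]) (simp add: regular_at_to_fract del: mult_pCons_left)
qed

lemma vanishes_at_to_fract_diff:
  assumes "poly p z = poly r z"
  shows "vanishes_at z 1 (to_fract p - to_fract r)"
  using vanishes_at_to_fract[of "p - r" z] assms by simp

lemma vanishes_at_prod_diff:
  assumes "\<And>i. i \<in> I \<Longrightarrow> vanishes_at z e (f i - g i)" "\<And>i. i \<in> I \<Longrightarrow> regular_at z (f i)"
    "\<And>i. i \<in> I \<Longrightarrow> regular_at z (g i)"
  shows "vanishes_at z e (prod f I - prod g I)"
  using assms
proof (induction I rule: infinite_finite_induct)
  case (insert i I)
  have "prod f (insert i I) - prod g (insert i I) = (f i - g i) * prod f I + g i * (prod f I - prod g I)"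
    using insert.hyps by (simp add: algebra_simps)
  moreover have "vanishes_at z e ((f i - g i) * prod f I)"
    using insert.prems by (intro vanishes_at_mult_left regular_at_prod) auto
  moreover have "vanishes_at z e (g i * (prod f I - prod g I))"
    using insert by (intro vanishes_at_mult_right) auto
  ultimately show ?case
    using vanishes_at_add by simp
qed (simp_all add: vanishes_at_0)

lemma vanishes_at_mult_diff:
  assumes "vanishes_at z e (A - B)" "vanishes_at z e (C - D)" "regular_at z B" "regular_at z C"
  shows "vanishes_at z e (A * C - B * D)"
proof -
  have "A * C - B * D = (A - B) * C + B * (C - D)"
    by (simp add: algebra_simps)
  then show ?thesis
    using assms by (simp add: vanishes_at_add vanishes_at_mult_left vanishes_at_mult_right)
qed

lemma vanishes_at_divide_diff:
  assumes "vanishes_at z e (A - B)" "vanishes_at z e (C - D)" "regular_at z B" "unit_at z C" "unit_at z D"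
  shows "vanishes_at z e (A / C - B / D)"
proof -
  have "A / C - B / D = ((A - B) * D - B * (C - D)) / (C * D)"
    using unit_at_nonzero[OF assms(4)] unit_at_nonzero[OF assms(5)] by (simp add: field_simps)
  moreover have "vanishes_at z e ((A - B) * D)" "vanishes_at z e (B * (C - D))" "unit_at z (C * D)"
    using assms by (simp_all add: vanishes_at_mult_left vanishes_at_mult_right unit_at_imp_regular_at unit_at_mult)
  ultimately show ?thesis
    using vanishes_at_divide vanishes_at_diff by simp
qed

section \<open>Local behaviour of 1 - q^N\<close>

lemma unit_at_one_minus_power:
  assumes "z ^ N \<noteq> 1"
  shows "unit_at z (1 - ratq ^ N)"
proof -
  have "unit_at z (to_fract (1 - polq ^ N))"
    using assms by (intro unit_at_to_fract) simp
  then show ?thesis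
    by (simp add: to_fract_power)
qed

text \<open>The derivative -N q^(N - 1) does not vanish at the nonzero point \<open>z\<close>, so
  the cofactor of q - z is a unit there.\<close>

lemma one_minus_power_simple_zero:
  assumes "z ^ N = 1" "0 < N"
  obtains C where "unit_at z C" "1 - ratq ^ N = to_fract [:- z, 1:] * C"
proof -
  have z0: "z \<noteq> 0"
    using assms by (metis power_0_left less_irrefl zero_neq_one)
  have "poly (1 - polq ^ N) z = 0"
    using assms by simp
  then obtain r where r: "1 - polq ^ N = [:- z, 1:] * r"
    unfolding poly_eq_0_iff_dvd by blast
  have "pderiv (1 - polq ^ N) = - Polynomial.smult (of_nat N) (polq ^ (N - 1))"
    using assms(2) by (cases N) (simp_all add: pderiv_diff pderiv_power_Suc pderiv_pCons del: power_Suc)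
  then have "poly (pderiv (1 - polq ^ N)) z = - of_nat N * z ^ (N - 1)"
    by simp
  moreover have "poly (pderiv (1 - polq ^ N)) z = poly r z"
    unfolding r pderiv_mult by (simp add: pderiv_pCons)
  ultimately have "poly r z \<noteq> 0"
    using z0 assms(2) by auto
  moreover have "1 - ratq ^ N = to_fract [:- z, 1:] * to_fract r"
    unfolding to_fract_mult[symmetric] r[symmetric] by (simp add: to_fract_power)
  ultimately show ?thesis
    using that unit_at_to_fract by blast
qed

lemma vanishes_at_one_minus_power: "z ^ N = 1 \<Longrightarrow> vanishes_at z 1 (1 - ratq ^ N)"
  using vanishes_at_to_fract[of "1 - polq ^ N" z] by (simp add: to_fract_power)

lemma regular_at_ratq_power: "regular_at z (ratq ^ N)"
  by (intro regular_at_power regular_at_to_fract)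

lemma regular_at_one_minus_power: "regular_at z (1 - ratq ^ N)"
  by (intro regular_at_diff regular_at_1 regular_at_ratq_power)

lemma vanishes_at_ratq_power_diff: "z ^ i = z ^ j \<Longrightarrow> vanishes_at z 1 (ratq ^ i - ratq ^ j)"
  using vanishes_at_to_fract_diff[of "polq ^ i" z "polq ^ j"] by (simp add: to_fract_power)

lemma vanishes_divide_simple_zero:
  assumes "vanishes_at z 1 A" "unit_at z C" "B = to_fract [:- z, 1:] * C"
  shows "regular_at z (A / B)"
proof -
  obtain D where D: "regular_at z D" "A = to_fract [:- z, 1:] * D"
    using assms(1) unfolding vanishes_at_def by auto
  have "to_fract [:- z, 1:] \<noteq> 0"
    by simp
  then have "A / B = D / C"
    unfolding D(2) assms(3) by (metis mult_divide_mult_cancel_left)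
  then show ?thesis
    using D(1) assms(2) by (simp add: regular_at_divide)
qed

lemma vanishes_at_divide_one_minus_power:
  assumes "vanishes_at z 1 A" "0 < N"
  shows "regular_at z (A / (1 - ratq ^ N))"
proof (cases "z ^ N = 1")
  case True
  from one_minus_power_simple_zero[OF this assms(2)] show ?thesis
    using vanishes_divide_simple_zero[OF assms(1)] by metis
next
  case False
  show ?thesis
    by (rule regular_at_divide[OF vanishes_at_regular[OF assms(1)] unit_at_one_minus_power[OF False]])
qed

section \<open>From local orders to a congruence\<close>

lemma coprime_complex_polyI:
  fixes p r :: "complex poly"
  assumes "p \<noteq> 0" "\<And>z. poly p z = 0 \<Longrightarrow> poly r z = 0 \<Longrightarrow> False"
  shows "coprime p r"
proof (rule coprimeI)
  fix c
  assume c: "c dvd p" "c dvd r"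
  then have "c \<noteq> 0"
    using assms(1) by auto
  have "degree c = 0"
  proof (rule ccontr)
    assume "degree c \<noteq> 0"
    then have "\<not> constant (poly c)"
      by (simp add: constant_degree)
    then obtain z where "poly c z = 0"
      using fundamental_theorem_of_algebra by blast
    then have "poly p z = 0" "poly r z = 0"
      using c by (auto elim!: dvdE)
    then show False
      by (rule assms(2))
  qed
  then show "is_unit c"
    using \<open>c \<noteq> 0\<close> by (simp add: is_unit_iff_degree)
qed

text \<open>Take a representation whose denominator has least degree: a common root would allow a
  linear factor to be cancelled.\<close>

lemma fract_no_common_root:
  fixes X :: "complex poly fract"
  obtains a b where "b \<noteq> 0" "X = Fract a b" "\<And>z. poly a z = 0 \<Longrightarrow> poly b z = 0 \<Longrightarrow> False"
proof -
  define P where "P = (\<lambda>p. snd p \<noteq> 0 \<and> X = Fract (fst p) (snd p))"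
  obtain a0 b0 where "P (a0, b0)"
    unfolding P_def by (cases X) auto
  then obtain p where p: "P p" "\<And>p'. P p' \<Longrightarrow> degree (snd p) \<le> degree (snd p')"
    using ex_has_least_nat[of P "(a0, b0)" "\<lambda>p. degree (snd p)"] by blast
  show ?thesis
  proof (rule that[of "snd p" "fst p"])
    fix z
    assume "poly (fst p) z = 0" "poly (snd p) z = 0"
    then obtain a b where ab: "fst p = [:- z, 1:] * a" "snd p = [:- z, 1:] * b"
      unfolding poly_eq_0_iff_dvd by (meson dvdE)
    have b0: "b \<noteq> 0"
      using p(1) ab(2) unfolding P_def by auto
    have "Fract (fst p) (snd p) = Fract a b"
      unfolding ab by (rule mult_fract_cancel) simp
    then have "P (a, b)"
      using p(1) b0 unfolding P_def by simp
    then have "degree (snd p) \<le> degree b"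
      using p(2) by fastforce
    moreover have "degree (snd p) = 1 + degree b"
      unfolding ab using b0 by (subst degree_mult_eq) auto
    ultimately show False
      by simp
  qed (use p(1) in \<open>auto simp: P_def\<close>)
qed

text \<open>The linear factors are distinct, so the product over the other indices does not vanish
  at \<open>\<zeta> i\<close>, and the order of \<open>a\<close> there is that of the
  cofactor.\<close>

lemma prod_linear_powers_dvd:
  fixes \<zeta> :: "'i \<Rightarrow> complex"
  assumes "finite I" "inj_on \<zeta> I" "\<And>i. i \<in> I \<Longrightarrow> [:- \<zeta> i, 1:] ^ e i dvd a"
  shows "(\<Prod>i\<in>I. [:- \<zeta> i, 1:] ^ e i) dvd a"
  using assms
proof (induction I rule: finite_induct)
  case (insert i I)
  then obtain r where r: "a = (\<Prod>i\<in>I. [:- \<zeta> i, 1:] ^ e i) * r"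
    by (auto elim!: dvdE)
  have nz: "poly (\<Prod>i\<in>I. [:- \<zeta> i, 1:] ^ e i) (\<zeta> i) \<noteq> 0"
    using insert.hyps insert.prems(1) by (auto simp: poly_prod inj_on_def)
  have "[:- \<zeta> i, 1:] ^ e i dvd r"
  proof (cases "r = 0")
    case False
    then have "a \<noteq> 0"
      using nz r by auto
    then have "Polynomial.order (\<zeta> i) a = Polynomial.order (\<zeta> i) r"
      using nz unfolding r by (simp add: order_mult order_0I)
    then show ?thesis
      using insert.prems(2)[of i] False \<open>a \<noteq> 0\<close> by (simp add: order_divides)
  qed simp
  then show ?case
    using insert.hyps unfolding r by (simp add: mult.commute mult_dvd_mono)
qed simp

lemma denominator_nonzero:
  assumes "b \<noteq> 0" "regular_at z (Fract a b)" "poly a z = 0 \<Longrightarrow> poly b z = 0 \<Longrightarrow> False"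
  shows "poly b z \<noteq> 0"
proof
  assume b0: "poly b z = 0"
  obtain c d where cd: "to_fract a / to_fract b = to_fract c / to_fract d" "poly d z \<noteq> 0"
    using assms(2) unfolding regular_at_def Fract_conv_to_fract by blast
  then have "d \<noteq> 0"
    by auto
  have "to_fract (a * d) = to_fract (c * b)"
    using cd(1) assms(1) \<open>d \<noteq> 0\<close> unfolding to_fract_mult by (simp add: frac_eq_eq)
  then have "a * d = c * b"
    by (simp only: to_fract_eq_iff)
  then have "poly a z * poly d z = poly c z * poly b z"
    by (metis poly_mult)
  then show False
    using b0 cd(2) assms(3) by simp
qed

text \<open>A single fraction a / b without common roots serves all points at once: the local orders
  put each power into \<open>a\<close>, regularity makes \<open>b\<close> nonzero at every
  \<open>\<zeta> i\<close>, and all roots of \<open>P\<close> are among these points.\<close>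

lemma local_to_global:
  fixes \<zeta> :: "'i \<Rightarrow> complex"
  assumes "finite I" "inj_on \<zeta> I" and X: "\<And>i. i \<in> I \<Longrightarrow> vanishes_at (\<zeta> i) (e i) X"
    and P: "P dvd (\<Prod>i\<in>I. [:- \<zeta> i, 1:] ^ e i)"
  shows "\<exists>a b. b \<noteq> 0 \<and> X = Fract a b \<and> P dvd a \<and> coprime b P"
proof -
  obtain a b where ab: "b \<noteq> 0" "X = Fract a b" "\<And>z. poly a z = 0 \<Longrightarrow> poly b z = 0 \<Longrightarrow> False"
    using fract_no_common_root by metis
  have *: "[:- \<zeta> i, 1:] ^ e i dvd a \<and> poly b (\<zeta> i) \<noteq> 0" if i: "i \<in> I" for i
  proof -
    obtain c d where cd: "X = to_fract [:- \<zeta> i, 1:] ^ e i * (to_fract c / to_fract d)" "poly d (\<zeta> i) \<noteq> 0"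
      using X[OF i] unfolding vanishes_at_def regular_at_def by blast
    have "d \<noteq> 0"
      using cd(2) by auto
    have "to_fract a / to_fract b = to_fract ([:- \<zeta> i, 1:] ^ e i) * to_fract c / to_fract d"
      using cd(1) unfolding ab(2) Fract_conv_to_fract to_fract_power by simp
    then have "to_fract (a * d) = to_fract (b * ([:- \<zeta> i, 1:] ^ e i * c))"
      using ab(1) \<open>d \<noteq> 0\<close> unfolding to_fract_mult by (simp add: frac_eq_eq mult_ac del: mult_pCons_left)
    then have eq: "a * d = b * ([:- \<zeta> i, 1:] ^ e i * c)"
      by (simp only: to_fract_eq_iff)
    have b: "poly b (\<zeta> i) \<noteq> 0"
      using denominator_nonzero[OF ab(1) vanishes_at_regular[OF X[OF i, unfolded ab(2)]]] ab(3) by blast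
    have dvd: "[:- \<zeta> i, 1:] ^ e i dvd a * d"
      unfolding eq by simp
    have "[:- \<zeta> i, 1:] ^ e i dvd a"
    proof (cases "a = 0")
      case False
      then show ?thesis
        using dvd cd(2) \<open>d \<noteq> 0\<close> by (simp add: order_divides order_mult order_0I)
    qed simp
    then show ?thesis
      using b ..
  qed
  have "P dvd a"
    using P prod_linear_powers_dvd[OF assms(1,2), of e a] * dvd_trans by blast
  moreover have "coprime b P"
  proof (rule coprime_complex_polyI[OF ab(1)])
    fix z
    assume z: "poly b z = 0" "poly P z = 0"
    then have "poly (\<Prod>i\<in>I. [:- \<zeta> i, 1:] ^ e i) z = 0"
      using P by (auto elim!: dvdE)
    then obtain i where "i \<in> I" "z = \<zeta> i"
      using assms(1) by (auto simp: poly_prod)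
    then show False
      using * z(1) by blast
  qed
  ultimately show ?thesis
    using ab by blast
qed

lemma regular_denom_coprime:
  fixes \<zeta> :: "'i \<Rightarrow> complex"
  assumes "finite I" and X: "\<And>i. i \<in> I \<Longrightarrow> regular_at (\<zeta> i) X"
    and P: "P dvd (\<Prod>i\<in>I. [:- \<zeta> i, 1:] ^ e i)"
  shows "denom_coprime X P"
proof -
  obtain a b where ab: "b \<noteq> 0" "X = Fract a b" "\<And>z. poly a z = 0 \<Longrightarrow> poly b z = 0 \<Longrightarrow> False"
    using fract_no_common_root by metis
  have "coprime b P"
  proof (rule coprime_complex_polyI[OF ab(1)])
    fix z
    assume z: "poly b z = 0" "poly P z = 0"
    then have "poly (\<Prod>i\<in>I. [:- \<zeta> i, 1:] ^ e i) z = 0"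
      using P by (auto elim!: dvdE)
    then obtain i where "i \<in> I" "z = \<zeta> i"
      using assms(1) by (auto simp: poly_prod)
    then show False
      using denominator_nonzero[OF ab(1) X[unfolded ab(2)]] ab(3) z(1) by blast
  qed
  then show ?thesis
    unfolding denom_coprime_def using ab by blast
qed

lemma to_fract_sum_num:
  "to_fract (sum_num M polq 0) = sum_num M ratq 0"
proof -
  interpret ring_homomorphism "to_fract :: complex poly \<Rightarrow> complex poly fract"
    by unfold_locales auto
  show ?thesis
    by (simp add: hom_sum_num)
qed

section \<open>The sum at a primitive root of unity\<close>

text \<open>\<open>ser_term k\<close> is \<open>1 - q\<close> times the summand of the theorem.\<close>

definition ser_term :: "nat \<Rightarrow> complex poly fract" where
  "ser_term k = sum_weight ratq k * (\<Prod>j<k. num_factor ratq 0 j / den_factor ratq 0 j)"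

text \<open>The quotient of consecutive summands, up to the outer factors of
  \<open>ser_term\<close>. The grouping matters: at a primitive d-th root of unity with d odd, the
  numerators of each of the two quotients have a zero in every block of d indices, which offsets the
  single zero of the denominators.\<close>

definition ser_ratio :: "nat \<Rightarrow> complex poly fract" where
  "ser_ratio j = ((1 - ratq ^ (2 * j + 1)) / (1 - ratq ^ (4 * j + 4))) ^ 3
     * ((1 - ratq ^ (4 * j + 1)) / (1 - ratq ^ (2 * j + 2)))"

lemma ser_term_eq: "ser_term k = (1 - ratq ^ (6 * k + 1)) * ratq ^ (k\<^sup>2 + k) * (\<Prod>j<k. ser_ratio j)"
proof -
  have "qpochhammer ratq (ratq ^ 4) k = (\<Prod>j<k. 1 - ratq ^ (4 * j + 1))"
    unfolding qpochhammer_def by (simp add: power_mult)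
  moreover have "(\<Prod>j<k. ser_ratio j)
     = (\<Prod>j<k. 1 - ratq ^ (4 * j + 1)) * (\<Prod>j<k. num_factor ratq 0 j / den_factor ratq 0 j)"
    unfolding prod.distrib[symmetric]
    by (intro prod.cong refl) (simp add: ser_ratio_def num_factor_def den_factor_def power_divide mult_ac)
  ultimately show ?thesis
    unfolding ser_term_def sum_weight_def by (simp only: mult_ac)
qed

text \<open>The zero of \<open>g\<close> in a block sits at its last index, where d divides j + 1. A
  complete block therefore pairs one simple pole with a zero of \<open>f\<close>, and an incomplete
  block has no pole yet.\<close>

lemma regular_at_blocks:
  fixes f g :: "nat \<Rightarrow> complex poly fract"
  assumes d: "0 < d"
    and f: "\<And>j. regular_at z (f j)"
    and g: "\<And>j. \<not> d dvd Suc j \<Longrightarrow> unit_at z (g j)"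
    and g': "\<And>j. d dvd Suc j \<Longrightarrow> \<exists>C. unit_at z C \<and> g j = to_fract [:- z, 1:] * C"
    and f': "\<And>i. \<exists>j\<in>{i * d..<i * d + d}. vanishes_at z 1 (f j)"
  shows "regular_at z (\<Prod>j<k. f j / g j)"
proof -
  have nd: "\<not> d dvd Suc j" if "i * d < Suc j" "Suc j < (i + 1) * d" for i j
  proof
    assume "d dvd Suc j"
    then obtain c where "Suc j = d * c" ..
    then have "i < c" "c < i + 1"
      using that by (metis mult.commute mult_less_cancel2)+
    then show False
      by simp
  qed
  have part: "regular_at z (\<Prod>j=i * d..<i * d + l. f j / g j)" if "l < d" for i l
    using that by (intro regular_at_prod regular_at_divide f g nd[of i]) auto
  have full: "regular_at z (\<Prod>j=i * d..<i * d + d. f j / g j)" for i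
  proof -
    define J where "J = {i * d..<i * d + d}"
    define t where "t = i * d + (d - 1)"
    have t: "t \<in> J" "d dvd Suc t"
      using d by (simp_all add: J_def t_def)
    obtain C where C: "unit_at z C" "g t = to_fract [:- z, 1:] * C"
      using g'[OF t(2)] by blast
    have J: "J = insert t {i * d..<i * d + (d - 1)}"
      using d by (auto simp: J_def t_def)
    have U: "unit_at z (prod g {i * d..<i * d + (d - 1)})"
      by (intro unit_at_prod g nd[of i]) auto
    have "prod g J = g t * prod g {i * d..<i * d + (d - 1)}"
      unfolding J by (subst prod.insert) (auto simp: t_def)
    then have "prod g J = to_fract [:- z, 1:] * (C * prod g {i * d..<i * d + (d - 1)})"
      unfolding C(2) by (simp only: mult.assoc)
    moreover have "vanishes_at z 1 (prod f J)"
      using f' f by (metis J_def finite_atLeastLessThan vanishes_at_prod)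
    ultimately have "regular_at z (prod f J / prod g J)"
      using vanishes_divide_simple_zero[OF _ unit_at_mult[OF C(1) U]] by blast
    then show ?thesis
      by (simp add: prod_dividef J_def)
  qed
  have k: "k = k div d * d + k mod d"
    by simp
  have "(\<Prod>j<k. f j / g j) = (\<Prod>j<k div d * d. f j / g j) * (\<Prod>j=k div d * d..<k. f j / g j)"
    by (rule prod_lessThan_split[symmetric]) simp
  also have "(\<Prod>j<k div d * d. f j / g j) = (\<Prod>i<k div d. \<Prod>j=i * d..<i * d + d. f j / g j)"
    by (rule prod.nat_group[symmetric])
  finally show ?thesis
    using part[of "k mod d" "k div d"] d k by (simp add: regular_at_mult regular_at_prod full)
qed

lemma prod_shift: "(\<Prod>j<a + b. f j) = (\<Prod>j<a. f j) * (\<Prod>j<b. f (a + j))" for f :: "nat \<Rightarrow> 'a::comm_monoid_mult"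
  by (induction b) (simp_all add: mult_ac)

lemma sum_shift: "(\<Sum>j<a + b. f j) = (\<Sum>j<a. f j) + (\<Sum>j<b. f (a + j))" for f :: "nat \<Rightarrow> 'a::comm_monoid_add"
  by (induction b) (simp_all add: add_ac)

text \<open>In the application d runs over divisors of n other than 1. Oddness makes z^2 and z^4
  have order d as well, so the denominators vanish exactly where d divides j + 1.\<close>

locale primitive_root =
  fixes z :: complex and d :: nat
  assumes odd_d: "odd d" and d_gt_1: "1 < d" and z_d: "z ^ d = 1"
    and z_primitive: "\<And>i. 0 < i \<Longrightarrow> i < d \<Longrightarrow> z ^ i \<noteq> 1"
begin

lemma power_eq_1_iff: "z ^ i = 1 \<longleftrightarrow> d dvd i"
proof -
  have "z ^ i = z ^ (d * (i div d) + i mod d)"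
    by simp
  also have "\<dots> = z ^ (i mod d)"
    unfolding power_add power_mult z_d by simp
  finally show ?thesis
    using z_primitive[of "i mod d"] d_gt_1 by (auto simp: dvd_eq_mod_eq_0)
qed

lemma power_cong: "z ^ (a * d + i) = z ^ i"
  by (simp add: power_add mult.commute[of a] power_mult z_d)

lemma z_nonzero: "z \<noteq> 0"
  using z_d d_gt_1 by (metis power_0_left zero_neq_one not_less_zero)

lemma d_dvd_double_iff: "d dvd 2 * i \<longleftrightarrow> d dvd i"
  using odd_d by (metis coprime_dvd_mult_right_iff coprime_right_2_iff_odd)

lemma d_dvd_quad_iff: "d dvd 4 * i \<longleftrightarrow> d dvd i"
  using d_dvd_double_iff[of "2 * i"] d_dvd_double_iff[of i] by simp

lemma unit_double: "\<not> d dvd Suc j \<Longrightarrow> unit_at z (1 - ratq ^ (2 * j + 2))"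
  and zero_double: "d dvd Suc j \<Longrightarrow> \<exists>C. unit_at z C \<and> 1 - ratq ^ (2 * j + 2) = to_fract [:- z, 1:] * C"
proof -
  have eq: "2 * j + 2 = 2 * Suc j"
    by simp
  have iff: "z ^ (2 * Suc j) = 1 \<longleftrightarrow> d dvd Suc j"
    unfolding power_eq_1_iff by (rule d_dvd_double_iff)
  show "\<not> d dvd Suc j \<Longrightarrow> unit_at z (1 - ratq ^ (2 * j + 2))"
    unfolding eq iff[symmetric] by (rule unit_at_one_minus_power)
  show "d dvd Suc j \<Longrightarrow> \<exists>C. unit_at z C \<and> 1 - ratq ^ (2 * j + 2) = to_fract [:- z, 1:] * C"
    unfolding eq iff[symmetric] by (erule one_minus_power_simple_zero[of z "2 * Suc j"]) auto
qed

lemma unit_quad: "\<not> d dvd Suc j \<Longrightarrow> unit_at z (1 - ratq ^ (4 * j + 4))"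
  and zero_quad: "d dvd Suc j \<Longrightarrow> \<exists>C. unit_at z C \<and> 1 - ratq ^ (4 * j + 4) = to_fract [:- z, 1:] * C"
proof -
  have eq: "4 * j + 4 = 4 * Suc j"
    by simp
  have iff: "z ^ (4 * Suc j) = 1 \<longleftrightarrow> d dvd Suc j"
    unfolding power_eq_1_iff by (rule d_dvd_quad_iff)
  show "\<not> d dvd Suc j \<Longrightarrow> unit_at z (1 - ratq ^ (4 * j + 4))"
    unfolding eq iff[symmetric] by (rule unit_at_one_minus_power)
  show "d dvd Suc j \<Longrightarrow> \<exists>C. unit_at z C \<and> 1 - ratq ^ (4 * j + 4) = to_fract [:- z, 1:] * C"
    unfolding eq iff[symmetric] by (erule one_minus_power_simple_zero[of z "4 * Suc j"]) auto
qed

lemma not_dvd_Suc: "j < d - 1 \<Longrightarrow> \<not> d dvd Suc j"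
  using dvd_imp_le[of d "Suc j"] by fastforce

text \<open>\<open>m\<close> is -1/4 modulo d, the index of a factor of (q; q^4)_k that vanishes at
  \<open>z\<close>. A divisor of n can be 3 modulo 4, and then 4 m + 1 = 3 d takes the place of
  d.\<close>

lemma obtain_quarter:
  obtains m where "m < d" "d dvd 4 * m + 1"
proof -
  have "d mod 4 = 1 \<or> d mod 4 = 3"
    using odd_d by presburger
  then consider "d mod 4 = 1" | "d mod 4 = 3"
    by blast
  then show ?thesis
  proof cases
    case 1
    then have "4 * ((d - 1) div 4) + 1 = d"
      by presburger
    then show ?thesis
      using that[of "(d - 1) div 4"] d_gt_1 by simp
  next
    case 2
    then have "4 * ((3 * d - 1) div 4) + 1 = 3 * d"
      by presburger
    then show ?thesis
      using that[of "(3 * d - 1) div 4"] d_gt_1 by simp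
  qed
qed

lemma sum_num_eq_0: "sum_num (d - 1) z x = 0"
proof -
  obtain m where m: "m < d" "d dvd 4 * m + 1"
    by (rule obtain_quarter)
  have "z ^ (4 * m + 1) = 1"
    unfolding power_eq_1_iff by (rule m(2))
  then show ?thesis
    using sum_num_root_of_unity[OF odd_d z_d, of m "d - 1" x] z_primitive m(1) by simp
qed

lemma den_factor_unit: "j < d - 1 \<Longrightarrow> unit_at z (den_factor ratq 0 j)"
  unfolding den_factor_def using unit_double[of j] unit_quad[of j] not_dvd_Suc[of j]
  by (simp only: mult_zero_left diff_zero) (intro unit_at_mult unit_at_power; blast)

lemma sum_den_unit: "unit_at z (sum_den (d - 1) ratq 0)"
  unfolding sum_den_def by (intro unit_at_prod den_factor_unit) simp

lemma sum_ser_term: "(\<Sum>k<d. ser_term k) = sum_num (d - 1) ratq 0 / sum_den (d - 1) ratq 0"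
proof -
  have "{..<d} = {..d - 1}"
    using d_gt_1 by auto
  moreover have "sum_num (d - 1) ratq 0 = sum_den (d - 1) ratq 0 * (\<Sum>k\<le>d - 1. ser_term k)"
    unfolding ser_term_def by (rule sum_num_eq) (rule unit_at_nonzero[OF den_factor_unit])
  ultimately show ?thesis
    using unit_at_nonzero[OF sum_den_unit] by simp
qed

lemma vanishes_sum_ser_term: "vanishes_at z 1 (\<Sum>k<d. ser_term k)"
proof -
  interpret h: ring_homomorphism "\<lambda>p::complex poly. poly p z"
    by (rule ring_homomorphism_poly)
  have "poly (sum_num (d - 1) polq 0) z = 0"
    using sum_num_eq_0[of 0] by (simp add: h.hom_sum_num)
  then have "vanishes_at z 1 (sum_num (d - 1) ratq 0)"
    using vanishes_at_to_fract to_fract_sum_num by metis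
  then show ?thesis
    unfolding sum_ser_term by (rule vanishes_at_divide[OF _ sum_den_unit])
qed

lemma half: "2 * ((d - 1) div 2) + 1 = d"
  using odd_d by presburger

text \<open>The index j = (d - 1) / 2 has 2 j + 1 = d, so its numerator is (1 - q^d)^3; for k < d
  all denominators are units.\<close>

lemma vanishes_num:
  assumes "(d - 1) div 2 < k" "k < d"
  shows "vanishes_at z 3 (\<Prod>j<k. num_factor ratq 0 j / den_factor ratq 0 j)"
proof (rule vanishes_at_prod)
  show "(d - 1) div 2 \<in> {..<k}"
    using assms by simp
  have "vanishes_at z (3 * 1) ((1 - ratq ^ d) ^ 3)"
    by (intro vanishes_at_power vanishes_at_one_minus_power z_d)
  then have "vanishes_at z 3 (num_factor ratq 0 ((d - 1) div 2))"
    unfolding num_factor_def half by simp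
  then show "vanishes_at z 3 (num_factor ratq 0 ((d - 1) div 2) / den_factor ratq 0 ((d - 1) div 2))"
    using assms by (intro vanishes_at_divide den_factor_unit) auto
  show "regular_at z (num_factor ratq 0 j / den_factor ratq 0 j)" if "j \<in> {..<k}" for j
    using that assms unfolding num_factor_def
    by (intro regular_at_divide den_factor_unit) (auto intro!: regular_at_power regular_at_one_minus_power simp del: power_Suc)
qed simp

lemma regular_sum_weight: "regular_at z (sum_weight ratq k)"
proof -
  have "sum_weight ratq k = to_fract ((1 - polq ^ (6 * k + 1)) * (\<Prod>j<k. 1 - polq ^ (4 * j + 1)) * polq ^ (k\<^sup>2 + k))"
  proof -
    interpret h: ring_homomorphism "to_fract :: complex poly \<Rightarrow> complex poly fract"
      by unfold_locales auto
    have "qpochhammer ratq (ratq ^ 4) k = (\<Prod>j<k. 1 - ratq ^ (4 * j + 1))"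
      unfolding qpochhammer_def by (simp add: power_mult)
    then show ?thesis
      unfolding sum_weight_def h.hom_mult h.hom_diff h.hom_power h.hom_prod h.hom_1 by simp
  qed
  then show ?thesis
    by (simp only: regular_at_to_fract)
qed

lemma vanishes_ser_term:
  assumes "(d - 1) div 2 < k" "k < d"
  shows "vanishes_at z 3 (ser_term k)"
  unfolding ser_term_def by (intro vanishes_at_mult_right regular_sum_weight vanishes_num assms)

text \<open>The summands from L to d - 1 vanish at \<open>z\<close>, so a truncation beyond the
  middle of a block behaves like the full block. This is what admits both choices of
  \<open>M\<close>.\<close>

lemma vanishes_sum_partial:
  assumes "(d - 1) div 2 < L" "L \<le> d"
  shows "vanishes_at z 1 (\<Sum>k<L. ser_term k)"
proof -
  have "(\<Sum>k<d. ser_term k) = (\<Sum>k<L. ser_term k) + (\<Sum>j<d - L. ser_term (L + j))"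
    using sum_shift[of ser_term L "d - L"] assms by simp
  moreover have "vanishes_at z 1 (\<Sum>j<d - L. ser_term (L + j))"
  proof (rule vanishes_at_sum)
    fix j
    assume "j \<in> {..<d - L}"
    then have "vanishes_at z 3 (ser_term (L + j))"
      using assms by (intro vanishes_ser_term) auto
    then show "vanishes_at z 1 (ser_term (L + j))"
      by (rule vanishes_at_mono) simp
  qed
  ultimately show ?thesis
    using vanishes_at_diff[OF vanishes_sum_ser_term] by (metis add_diff_cancel_right')
qed

section \<open>Periodicity in blocks of length d\<close>

lemma half_in_block: "\<exists>j\<in>{i * d..<i * d + d}. d dvd 2 * j + 1"
proof
  have "2 * (i * d + (d - 1) div 2) + 1 = 2 * i * d + d"
    using half by (simp add: algebra_simps)
  moreover have "d dvd 2 * i * d + d"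
    by simp
  ultimately show "d dvd 2 * (i * d + (d - 1) div 2) + 1"
    by (simp only:)
  show "i * d + (d - 1) div 2 \<in> {i * d..<i * d + d}"
    using d_gt_1 by auto
qed

lemma quarter_in_block: "\<exists>j\<in>{i * d..<i * d + d}. d dvd 4 * j + 1"
proof -
  obtain m where m: "m < d" "d dvd 4 * m + 1"
    by (rule obtain_quarter)
  have "4 * (i * d + m) + 1 = 4 * i * d + (4 * m + 1)"
    by simp
  then have "d dvd 4 * (i * d + m) + 1"
    using m(2) by (metis dvd_add dvd_triv_right)
  then show ?thesis
    using m(1) by (intro bexI[of _ "i * d + m"]) auto
qed

lemma regular_prod_ser_ratio: "regular_at z (\<Prod>j<k. ser_ratio j)"
proof -
  have "regular_at z (\<Prod>j<k. (1 - ratq ^ (2 * j + 1)) / (1 - ratq ^ (4 * j + 4)))"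
  proof (intro regular_at_blocks[of d] regular_at_one_minus_power unit_quad zero_quad)
    show "\<exists>j\<in>{i * d..<i * d + d}. vanishes_at z 1 (1 - ratq ^ (2 * j + 1))" for i
      using half_in_block[of i] vanishes_at_one_minus_power power_eq_1_iff by blast
  qed (use d_gt_1 in auto)
  moreover have "regular_at z (\<Prod>j<k. (1 - ratq ^ (4 * j + 1)) / (1 - ratq ^ (2 * j + 2)))"
  proof (intro regular_at_blocks[of d] regular_at_one_minus_power unit_double zero_double)
    show "\<exists>j\<in>{i * d..<i * d + d}. vanishes_at z 1 (1 - ratq ^ (4 * j + 1))" for i
      using quarter_in_block[of i] vanishes_at_one_minus_power power_eq_1_iff by blast
  qed (use d_gt_1 in auto)
  ultimately show ?thesis
    unfolding ser_ratio_def prod.distrib prod_power_distrib[symmetric]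
    by (intro regular_at_mult regular_at_power)
qed

lemma regular_prod_double_quad: "regular_at z (\<Prod>j<k. (1 - ratq ^ (4 * j + 2)) / (1 - ratq ^ (4 * j + 4)))"
proof (intro regular_at_blocks[of d] regular_at_one_minus_power unit_quad zero_quad)
  fix i
  obtain j where "j\<in>{i * d..<i * d + d}" "d dvd 2 * j + 1"
    using half_in_block by blast
  moreover from this have "d dvd 4 * j + 2"
    using d_dvd_double_iff[of "2 * j + 1"] by simp
  ultimately show "\<exists>j\<in>{i * d..<i * d + d}. vanishes_at z 1 (1 - ratq ^ (4 * j + 2))"
    by (intro bexI[of _ j] vanishes_at_one_minus_power) (simp_all only: power_eq_1_iff)
qed (use d_gt_1 in auto)

text \<open>All exponents change by multiples of d, so the values at \<open>z\<close> agree. The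
  last index of a block is excluded because its denominators vanish at \<open>z\<close>.\<close>

lemma vanishes_ratio_shift:
  assumes "j < d - 1"
  shows "vanishes_at z 1 (ser_ratio (a * d + j) - ser_ratio j)" "regular_at z (ser_ratio (a * d + j))"
proof -
  have u: "\<not> d dvd Suc (a * d + j)" for a
    using not_dvd_Suc[OF assms] dvd_add_right_iff[of d "a * d" "Suc j"] by simp
  have pw: "z ^ (c * (a * d + j) + e) = z ^ (c * j + e)" for c e
    using power_cong[of "c * a" "c * j + e"] by (simp add: algebra_simps)
  have v: "vanishes_at z 1 ((1 - ratq ^ (c * (a * d + j) + e)) - (1 - ratq ^ (c * j + e)))" for c e
    using vanishes_at_uminus[OF vanishes_at_ratq_power_diff[OF pw[of c e]]] by simp
  have u0: "\<not> d dvd Suc j"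
    by (rule not_dvd_Suc[OF assms])
  have 1: "vanishes_at z 1 ((1 - ratq ^ (2 * (a * d + j) + 1)) / (1 - ratq ^ (4 * (a * d + j) + 4))
     - (1 - ratq ^ (2 * j + 1)) / (1 - ratq ^ (4 * j + 4)))"
    by (intro vanishes_at_divide_diff v regular_at_one_minus_power unit_quad u u0)
  have 2: "vanishes_at z 1 ((1 - ratq ^ (4 * (a * d + j) + 1)) / (1 - ratq ^ (2 * (a * d + j) + 2))
     - (1 - ratq ^ (4 * j + 1)) / (1 - ratq ^ (2 * j + 2)))"
    by (intro vanishes_at_divide_diff v regular_at_one_minus_power unit_double u u0)
  have r1: "regular_at z ((1 - ratq ^ (2 * (a * d + j) + 1)) / (1 - ratq ^ (4 * (a * d + j) + 4)))" for a
    by (intro regular_at_divide regular_at_one_minus_power unit_quad u)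
  have r2: "regular_at z ((1 - ratq ^ (4 * (a * d + j) + 1)) / (1 - ratq ^ (2 * (a * d + j) + 2)))" for a
    by (intro regular_at_divide regular_at_one_minus_power unit_double u)
  have r3: "regular_at z (ser_ratio (a * d + j))" for a
    unfolding ser_ratio_def by (intro regular_at_mult regular_at_power r1 r2)
  have cube: "vanishes_at z 1 (A ^ 3 - B ^ 3)" if "vanishes_at z 1 (A - B)" "regular_at z A" "regular_at z B" for A B
    unfolding power3_eq_cube using that by (intro vanishes_at_mult_diff regular_at_mult)
  show "vanishes_at z 1 (ser_ratio (a * d + j) - ser_ratio j)"
    unfolding ser_ratio_def
    using r1[of a] r1[of 0] r2[of a] r2[of 0]
    by (intro vanishes_at_mult_diff cube 1 2 regular_at_power) simp_all
  show "regular_at z (ser_ratio (a * d + j))"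
    by (rule r3)
qed

text \<open>Removing the factor built from the indices below a d leaves \<open>R k\<close>, which
  agrees with \<open>ser_term k\<close> at \<open>z\<close>. By
  \<open>regular_prod_ser_ratio\<close> the removed factor is regular, although its denominators may
  have zeros at \<open>z\<close>, so multiplying by it preserves the vanishing.\<close>

lemma vanishes_sum_block:
  assumes "(d - 1) div 2 < L" "L \<le> d"
  shows "vanishes_at z 1 (\<Sum>k<L. ser_term (a * d + k))"
proof -
  define R where "R k = (1 - ratq ^ (6 * (a * d + k) + 1)) * ratq ^ ((a * d + k)\<^sup>2 + (a * d + k)) * (\<Prod>j<k. ser_ratio (a * d + j))" for k
  have "ser_term (a * d + k) = (\<Prod>j<a * d. ser_ratio j) * R k" for k
    unfolding ser_term_eq R_def prod_shift by (simp only: mult_ac)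
  then have eq: "(\<Sum>k<L. ser_term (a * d + k)) = (\<Prod>j<a * d. ser_ratio j) * (\<Sum>k<L. R k)"
    by (simp add: sum_distrib_left)
  have "vanishes_at z 1 (R k - ser_term k)" if "k < d" for k
  proof -
    have "z ^ (6 * (a * d + k) + 1) = z ^ (6 * k + 1)"
      using power_cong[of "6 * a" "6 * k + 1"] by (simp add: algebra_simps)
    from vanishes_at_uminus[OF vanishes_at_ratq_power_diff[OF this]]
    have 1: "vanishes_at z 1 ((1 - ratq ^ (6 * (a * d + k) + 1)) - (1 - ratq ^ (6 * k + 1)))"
      by simp
    have "(a * d + k)\<^sup>2 + (a * d + k) = (a * a * d + 2 * a * k + a) * d + (k\<^sup>2 + k)"
      by (simp add: power2_eq_square algebra_simps)
    then have 2: "vanishes_at z 1 (ratq ^ ((a * d + k)\<^sup>2 + (a * d + k)) - ratq ^ (k\<^sup>2 + k))"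
      using power_cong by (intro vanishes_at_ratq_power_diff) metis
    have "vanishes_at z 1 ((\<Prod>j<k. ser_ratio (a * d + j)) - (\<Prod>j<k. ser_ratio j))"
      using that vanishes_ratio_shift(2)[of _ 0]
      by (intro vanishes_at_prod_diff vanishes_ratio_shift) auto
    moreover have "regular_at z (\<Prod>j<k. ser_ratio (a * d + j))"
      using that by (intro regular_at_prod vanishes_ratio_shift) auto
    ultimately show ?thesis
      unfolding R_def ser_term_eq using 1 2
      by (intro vanishes_at_mult_diff regular_at_mult regular_at_one_minus_power regular_at_ratq_power)
  qed
  then have "vanishes_at z 1 (\<Sum>k<L. R k - ser_term k)"
    using assms by (intro vanishes_at_sum) auto
  from vanishes_at_add[OF this vanishes_sum_partial[OF assms]]
  have "vanishes_at z 1 (\<Sum>k<L. R k)"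
    by (simp add: sum_subtractf)
  then show ?thesis
    unfolding eq by (intro vanishes_at_mult_right regular_prod_ser_ratio)
qed

lemma vanishes_sum_ser_term_blocks:
  assumes "(d - 1) div 2 < L" "L \<le> d"
  shows "vanishes_at z 1 (\<Sum>k<a * d + L. ser_term k)"
proof -
  have "vanishes_at z 1 (\<Sum>k<a * d. ser_term k)"
  proof (induction a)
    case (Suc a)
    have "(d - 1) div 2 < d"
      using d_gt_1 by auto
    with Suc show ?case
      using vanishes_at_add[OF Suc vanishes_sum_block[of d a]] sum_shift[of ser_term "a * d" d]
      by (simp add: add.commute)
  qed (simp add: vanishes_at_0)
  then show ?thesis
    unfolding sum_shift using vanishes_sum_block[OF assms] by (rule vanishes_at_add)
qed

end

section \<open>Dependence on the deformation parameter x\<close>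

lemma unit_at_add_vanishing:
  assumes "unit_at z A" "vanishes_at z 1 B"
  shows "unit_at z (A + B)"
proof -
  obtain a b where ab: "A = to_fract a / to_fract b" "poly a z \<noteq> 0" "poly b z \<noteq> 0"
    using assms(1) unfolding unit_at_def by blast
  obtain c d where cd: "B = to_fract [:- z, 1:] * (to_fract c / to_fract d)" "poly d z \<noteq> 0"
    using assms(2) unfolding vanishes_at_def regular_at_def by auto
  have nz: "b \<noteq> 0" "d \<noteq> 0"
    using ab(3) cd(2) by auto
  have "A + B = to_fract (a * d + [:- z, 1:] * c * b) / to_fract (b * d)"
    unfolding ab(1) cd(1) to_fract_add to_fract_mult using nz
    by (simp add: field_simps del: mult_pCons_left)
  moreover have "poly (a * d + [:- z, 1:] * c * b) z \<noteq> 0" "poly (b * d) z \<noteq> 0"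
    using ab cd by simp_all
  ultimately show ?thesis
    unfolding unit_at_def by blast
qed

lemma regular_at_poly_fract_poly: "regular_at z x \<Longrightarrow> regular_at z (poly (fract_poly P) x)"
proof (induction P)
  case (pCons a P)
  then show ?case
    by (simp add: map_poly_pCons regular_at_add regular_at_mult regular_at_to_fract)
qed (simp add: regular_at_0)

lemma vanishes_at_poly_fract_poly_diff:
  assumes "vanishes_at z e x"
  shows "vanishes_at z e (poly (fract_poly P) x - poly (fract_poly P) 0)"
proof (cases P)
  case (pCons a Q)
  have "poly (fract_poly P) x - poly (fract_poly P) 0 = x * poly (fract_poly Q) x"
    unfolding pCons by (simp add: map_poly_pCons)
  then show ?thesis
    using assms by (simp add: vanishes_at_mult_left regular_at_poly_fract_poly vanishes_at_regular)
qed

text \<open>At q = z the polynomial vanishes as a function of the outer variable, so each of its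
  coefficients vanishes at \<open>z\<close> and is divisible by q - z.\<close>

lemma const_dvd_if_zero_specialization:
  fixes P :: "complex poly poly"
  assumes "\<And>y. poly (poly P [:y:]) z = 0"
  shows "[:[:- z, 1:]:] dvd P"
proof -
  have "poly (map_poly (\<lambda>p. poly p z) Q) y = poly (poly Q [:y:]) z" for y and Q :: "complex poly poly"
    by (induction Q) (simp_all add: map_poly_pCons)
  then have "\<forall>y. poly (map_poly (\<lambda>p. poly p z) P) y = 0"
    using assms by simp
  then have "map_poly (\<lambda>p. poly p z) P = 0"
    by (simp only: poly_all_0_iff_0)
  then have "poly (Polynomial.coeff P i) z = 0" for i
    by (metis coeff_map_poly coeff_0 poly_0)
  then show ?thesis
    unfolding const_poly_dvd_iff poly_eq_0_iff_dvd[symmetric] by blast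
qed

context primitive_root
begin

text \<open>
  One order beyond that of \<open>x\<close> is gained because \<open>sum_num (d - 1) q x\<close> vanishes identically in \<open>x\<close> at \<open>q = z\<close>.
\<close>

lemma vanishes_sum_num_diff:
  assumes "vanishes_at z 3 x"
  shows "vanishes_at z 4 (sum_num (d - 1) ratq x - sum_num (d - 1) ratq 0)"
proof -
  \<comment> \<open>A polynomial in two variables: the inner one is q, the outer one is x.\<close>
  define P :: "complex poly poly" where "P = sum_num (d - 1) [:polq:] [:0, 1:]"
  interpret p: ring_homomorphism "\<lambda>p. poly p y" for y :: "complex poly"
    by (rule ring_homomorphism_poly)
  interpret e: ring_homomorphism "\<lambda>p::complex poly. poly p z"
    by (rule ring_homomorphism_poly)
  interpret h: ring_homomorphism "\<lambda>P. poly (fract_poly P) y" for y :: "complex poly fract"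
    by (rule ring_homomorphism_poly_fract)
  have h: "poly (fract_poly P) y = sum_num (d - 1) ratq y" for y
    unfolding P_def h.hom_sum_num by (simp add: map_poly_pCons)
  have "[:[:- z, 1:]:] dvd P"
  proof (rule const_dvd_if_zero_specialization)
    show "poly (poly P [:y:]) z = 0" for y
      unfolding P_def p.hom_sum_num e.hom_sum_num by (simp add: sum_num_eq_0 del: One_nat_def)
  qed
  then obtain Q where Q: "P = [:[:- z, 1:]:] * Q" ..
  have "poly (fract_poly P) y = to_fract [:- z, 1:] * poly (fract_poly Q) y" for y
    unfolding Q h.hom_mult by (simp add: map_poly_pCons)
  then have eq: "sum_num (d - 1) ratq x - sum_num (d - 1) ratq 0
      = to_fract [:- z, 1:] * (poly (fract_poly Q) x - poly (fract_poly Q) 0)"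
    unfolding h[symmetric] by (simp only: right_diff_distrib)
  have "vanishes_at z 1 (to_fract [:- z, 1:])"
    by (rule vanishes_at_to_fract) simp
  from vanishes_at_mult[OF this vanishes_at_poly_fract_poly_diff[OF assms, of Q]]
  show ?thesis
    unfolding eq by simp
qed

text \<open>Order three suffices here: in \<open>vanishes_sum_minus_rhs\<close> this difference is
  multiplied by a quantity that vanishes once more.\<close>

lemma vanishes_sum_den_diff:
  assumes "vanishes_at z 3 x"
  shows "vanishes_at z 3 (sum_den (d - 1) ratq x - sum_den (d - 1) ratq 0)"
proof -
  interpret h: ring_homomorphism "\<lambda>P. poly (fract_poly P) y" for y :: "complex poly fract"
    by (rule ring_homomorphism_poly_fract)
  have "poly (fract_poly (sum_den (d - 1) [:polq:] [:0, 1:])) y = sum_den (d - 1) ratq y" for y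
    unfolding h.hom_sum_den by (simp add: map_poly_pCons)
  then show ?thesis
    using vanishes_at_poly_fract_poly_diff[OF assms] by metis
qed

end

lemma polq_power_neq_1: "0 < i \<Longrightarrow> polq ^ i \<noteq> 1"
  using degree_power_eq[of polq i] by auto

lemma ratq_power_neq_1: "0 < i \<Longrightarrow> ratq ^ i \<noteq> 1"
  by (metis polq_power_neq_1 to_fract_1 to_fract_eq_iff to_fract_power)

text \<open>\<open>rhs_main m\<close> is \<open>1 - q\<close> times the right-hand side of the theorem for \<open>n = 4 m + 1\<close>.\<close>

definition rhs_main :: "nat \<Rightarrow> complex poly fract" where
  "rhs_main m = (1 - ratq ^ (4 * m + 1)) / ratq ^ m
     * (\<Prod>j<m. (1 - ratq ^ (4 * j + 2)) / (1 - ratq ^ (4 * j + 4)))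
     * (1 - (\<Sum>j<m. ratq ^ (4 * j + 4) * ((1 - ratq ^ (4 * m + 1)) / (1 - ratq ^ (4 * j + 4)))\<^sup>2))"

section \<open>Comparison with the right-hand side to fourth order\<close>

context primitive_root
begin

lemma unit_ratq_power: "unit_at z (ratq ^ m)"
  by (intro unit_at_power unit_at_to_fract) (simp add: z_nonzero)

text \<open>If d < 4 m + 1, denominators 1 - q^(4 j + 4) may vanish at \<open>z\<close>. In the
  squared quotients these simple zeros are cancelled by 1 - q^(4 m + 1), in the product by the
  blockwise zeros of 1 - q^(4 j + 2).\<close>

lemma vanishes_rhs_main:
  assumes "d dvd 4 * m + 1"
  shows "vanishes_at z 1 (rhs_main m)"
proof -
  have v: "vanishes_at z 1 (1 - ratq ^ (4 * m + 1))"
    using assms by (intro vanishes_at_one_minus_power) (simp only: power_eq_1_iff)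
  have "regular_at z ((1 - ratq ^ (4 * m + 1)) / (1 - ratq ^ (4 * j + 4)))" for j
    by (rule vanishes_at_divide_one_minus_power[OF v]) simp
  then show ?thesis
    unfolding rhs_main_def
    by (intro vanishes_at_mult_left vanishes_at_divide v unit_ratq_power regular_prod_double_quad
        regular_at_diff regular_at_1 regular_at_sum regular_at_mult regular_at_ratq_power regular_at_power)
qed

text \<open>Modulo third order x drops out and \<epsilon> becomes t^2, so each factor is (1 - t^2 s)
  / (1 - Y) with s = Y / (1 - Y)^2. In the product the terms linear in t^2 give the sum, and the
  rest starts at t^4. This is the source of the terms q^(4 j) / [4 j]^2 of the theorem.\<close>

lemma product_expansion:
  fixes m :: nat and Y :: "nat \<Rightarrow> complex poly fract"
  assumes t: "vanishes_at z 1 t" and x: "vanishes_at z 3 x"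
    and \<epsilon>: "vanishes_at z 3 (\<epsilon> - t\<^sup>2)"
    and Y: "\<And>j. j < m \<Longrightarrow> regular_at z (Y j)" "\<And>j. j < m \<Longrightarrow> unit_at z (1 - Y j)"
  shows "vanishes_at z 3 ((\<Prod>j<m. ((1 - Y j)\<^sup>2 - Y j * \<epsilon>) / ((1 - Y j) ^ 3 - x * Y j))
     - (1 - t\<^sup>2 * (\<Sum>j<m. Y j / (1 - Y j)\<^sup>2)) / (\<Prod>j<m. 1 - Y j))"
  using Y
proof (induction m)
  case 0
  then show ?case by (simp add: vanishes_at_0)
next
  case (Suc m)
  have Yr: "regular_at z (Y m)" and Yu: "unit_at z (1 - Y m)"
    using Suc.prems by auto
  have nz: "1 - Y m \<noteq> 0"
    by (rule unit_at_nonzero[OF Yu])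
  have t2: "vanishes_at z 2 (t\<^sup>2)"
    using vanishes_at_power[OF t, of 2] by simp
  define S where "S = (\<Sum>j<m. Y j / (1 - Y j)\<^sup>2)"
  define E where "E = (\<Prod>j<m. 1 - Y j)"
  define s where "s = Y m / (1 - Y m)\<^sup>2"
  have Sr: "regular_at z S"
    unfolding S_def using Suc.prems by (intro regular_at_sum regular_at_divide unit_at_power) auto
  have sr: "regular_at z s"
    unfolding s_def by (intro regular_at_divide unit_at_power Yr Yu)
  have Eu: "unit_at z E"
    unfolding E_def using Suc.prems by (intro unit_at_prod) auto
  have den: "unit_at z ((1 - Y m) ^ 3 - x * Y m)"
  proof -
    have "vanishes_at z 1 (- (x * Y m))"
      using vanishes_at_uminus vanishes_at_mult_left[OF vanishes_at_mono[OF x] Yr] by simp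
    from unit_at_add_vanishing[OF unit_at_power[OF Yu, of 3] this] show ?thesis
      by simp
  qed
  have "vanishes_at z 3 (((1 - Y m)\<^sup>2 - Y m * \<epsilon>) / ((1 - Y m) ^ 3 - x * Y m)
      - ((1 - Y m)\<^sup>2 - Y m * t\<^sup>2) / (1 - Y m) ^ 3)"
  proof (rule vanishes_at_divide_diff)
    have "((1 - Y m)\<^sup>2 - Y m * \<epsilon>) - ((1 - Y m)\<^sup>2 - Y m * t\<^sup>2) = - (Y m * (\<epsilon> - t\<^sup>2))"
      by (simp add: algebra_simps)
    then show "vanishes_at z 3 (((1 - Y m)\<^sup>2 - Y m * \<epsilon>) - ((1 - Y m)\<^sup>2 - Y m * t\<^sup>2))"
      using vanishes_at_uminus[OF vanishes_at_mult_right[OF Yr \<epsilon>]] by simp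
    show "vanishes_at z 3 ((1 - Y m) ^ 3 - x * Y m - (1 - Y m) ^ 3)"
      using vanishes_at_uminus[OF vanishes_at_mult_left[OF x Yr]] by simp
    show "regular_at z ((1 - Y m)\<^sup>2 - Y m * t\<^sup>2)"
      using Yr Yu vanishes_at_regular[OF t2]
      by (simp add: regular_at_diff regular_at_mult regular_at_power unit_at_imp_regular_at)
    show "unit_at z ((1 - Y m) ^ 3)"
      by (intro unit_at_power Yu)
  qed (rule den)
  also have "((1 - Y m)\<^sup>2 - Y m * t\<^sup>2) / (1 - Y m) ^ 3 = (1 - t\<^sup>2 * s) / (1 - Y m)"
  proof -
    have "(v\<^sup>2 - y * r) / v ^ 3 = (1 - r * (y / v\<^sup>2)) / v" if "v \<noteq> 0" for v y r :: "complex poly fract"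
      using that by (simp add: field_simps power2_eq_square power3_eq_cube)
    from this[OF nz] show ?thesis
      unfolding s_def .
  qed
  finally have step: "vanishes_at z 3 (((1 - Y m)\<^sup>2 - Y m * \<epsilon>) / ((1 - Y m) ^ 3 - x * Y m) - (1 - t\<^sup>2 * s) / (1 - Y m))" .
  have IH: "vanishes_at z 3 ((\<Prod>j<m. ((1 - Y j)\<^sup>2 - Y j * \<epsilon>) / ((1 - Y j) ^ 3 - x * Y j)) - (1 - t\<^sup>2 * S) / E)"
    unfolding S_def E_def using Suc by simp
  have reg: "regular_at z ((1 - t\<^sup>2 * S) / E)"
    using Sr Eu vanishes_at_regular[OF t2] by (simp add: regular_at_divide regular_at_diff regular_at_1 regular_at_mult)
  have reg': "regular_at z (((1 - Y m)\<^sup>2 - Y m * \<epsilon>) / ((1 - Y m) ^ 3 - x * Y m))"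
  proof -
    have "regular_at z (\<epsilon> - t\<^sup>2 + t\<^sup>2)"
      by (intro regular_at_add vanishes_at_regular[OF \<epsilon>] vanishes_at_regular[OF t2])
    then have "regular_at z \<epsilon>"
      by simp
    then show ?thesis
      using den Yr Yu by (simp add: regular_at_divide regular_at_diff regular_at_mult regular_at_power unit_at_imp_regular_at)
  qed
  have "vanishes_at z 3 (t\<^sup>2 * t\<^sup>2 * (S * s / (E * (1 - Y m))))"
  proof (rule vanishes_at_mult_left)
    show "vanishes_at z 3 (t\<^sup>2 * t\<^sup>2)"
      using vanishes_at_mult[OF t2 t2] by (rule vanishes_at_mono) simp
    show "regular_at z (S * s / (E * (1 - Y m)))"
      by (intro regular_at_divide regular_at_mult Sr sr unit_at_mult Eu Yu)
  qed
  moreover have "(1 - t\<^sup>2 * S) / E * ((1 - t\<^sup>2 * s) / (1 - Y m)) - (1 - t\<^sup>2 * (S + s)) / (E * (1 - Y m))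
     = t\<^sup>2 * t\<^sup>2 * (S * s / (E * (1 - Y m)))"
  proof -
    have "(1 - r * S) / E * ((1 - r * s) / v) - (1 - r * (S + s)) / (E * v) = r * r * (S * s / (E * v))" for r v
      by (simp add: diff_divide_distrib[symmetric] algebra_simps)
    then show ?thesis .
  qed
  ultimately have "vanishes_at z 3 ((1 - t\<^sup>2 * S) / E * ((1 - t\<^sup>2 * s) / (1 - Y m)) - (1 - t\<^sup>2 * (S + s)) / (E * (1 - Y m)))"
    by simp
  from vanishes_at_add[OF vanishes_at_mult_diff[OF IH step reg reg'] this]
  have "vanishes_at z 3 ((\<Prod>j<m. ((1 - Y j)\<^sup>2 - Y j * \<epsilon>) / ((1 - Y j) ^ 3 - x * Y j))
      * (((1 - Y m)\<^sup>2 - Y m * \<epsilon>) / ((1 - Y m) ^ 3 - x * Y m)) - (1 - t\<^sup>2 * (S + s)) / (E * (1 - Y m)))"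
    by simp
  then show ?case
    unfolding S_def s_def E_def by simp
qed

lemma unit_quad_less: "j < d - 1 \<Longrightarrow> unit_at z (1 - ratq ^ (4 * j + 4))"
  by (intro unit_quad not_dvd_Suc)

text \<open>In the closed form N x = D x T H with T = t W / q^m three replacements are made: x by 0
  in \<open>N\<close>, an error of order four; x by 0 in \<open>D\<close> and \<open>H\<close> by
  \<open>H0\<close>, errors of order three that are multiplied by T, which vanishes once.\<close>

lemma vanishes_sum_minus_rhs:
  assumes d: "d = 4 * m + 1"
  shows "vanishes_at z 4 ((\<Sum>k<d. ser_term k) - rhs_main m)"
proof -
  define t where "t = 1 - ratq ^ d"
  define u where "u = inverse (ratq ^ d)"
  define x where "x = (1 - u) ^ 3 / u"
  \<comment> \<open>This is u + 1 / u - 2, so that (1 - u Y) (1 - Y / u) = (1 - Y)^2 - Y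
    \<epsilon>.\<close>
  define \<epsilon> where "\<epsilon> = t\<^sup>2 / ratq ^ d"
  define Y where "Y j = ratq ^ (4 * j + 4)" for j
  have q0: "ratq \<noteq> 0"
    by simp
  have u0: "u \<noteq> 0"
    by (simp add: u_def)
  have qu: "unit_at z u"
    unfolding u_def by (intro unit_at_inverse unit_ratq_power)
  have t: "vanishes_at z 1 t"
    unfolding t_def by (intro vanishes_at_one_minus_power z_d)
  have uq: "u * ratq ^ (4 * m + 1) = 1"
    unfolding u_def d by (rule left_inverse) simp
  have u1: "1 - u = - (t * u)"
    unfolding t_def u_def by (simp add: field_simps)
  have "x = - (t ^ 3 * u\<^sup>2)"
    unfolding x_def u1 using u0 by (simp add: field_simps power2_eq_square power3_eq_cube)
  moreover have "vanishes_at z (3 * 1) (t ^ 3)"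
    by (rule vanishes_at_power[OF t])
  ultimately have x: "vanishes_at z 3 x"
    using vanishes_at_uminus vanishes_at_mult_left regular_at_power[OF unit_at_imp_regular_at[OF qu]] by simp
  have "\<epsilon> - t\<^sup>2 = t ^ 3 * u"
    unfolding \<epsilon>_def t_def u_def by (simp add: field_simps power2_eq_square power3_eq_cube)
  then have \<epsilon>: "vanishes_at z 3 (\<epsilon> - t\<^sup>2)"
    using vanishes_at_mult_left[OF vanishes_at_power[OF t, of 3] unit_at_imp_regular_at[OF qu]] by simp
  have m: "m \<le> d - 1" "2 * m \<le> d - 1"
    using d by auto
  have Yu: "unit_at z (1 - Y j)" if "j < m" for j
    unfolding Y_def using that m by (intro unit_quad_less) auto
  have Yr: "regular_at z (Y j)" for j
    unfolding Y_def by (rule regular_at_ratq_power)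
  define H where "H = (\<Prod>j<m. ((1 - Y j)\<^sup>2 - Y j * \<epsilon>) / ((1 - Y j) ^ 3 - x * Y j))"
  define H0 where "H0 = (1 - t\<^sup>2 * (\<Sum>j<m. Y j / (1 - Y j)\<^sup>2)) / (\<Prod>j<m. 1 - Y j)"
  define W where "W = qpochhammer (ratq\<^sup>2) (ratq ^ 4) m"
  define N D where "N = sum_num (d - 1) ratq" and "D = sum_den (d - 1) ratq"
  have HH: "vanishes_at z 3 (H - H0)"
    unfolding H_def H0_def using t x \<epsilon> Yr Yu by (rule product_expansion)
  have W: "W = (\<Prod>j<m. 1 - ratq ^ (4 * j + 2))"
  proof -
    have "ratq\<^sup>2 * (ratq ^ 4) ^ j = ratq ^ (4 * j + 2)" for j
      unfolding power_add power_mult by (rule mult.commute)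
    then show ?thesis
      unfolding W_def qpochhammer_def by simp
  qed
  have Wr: "regular_at z W"
    unfolding W by (intro regular_at_prod regular_at_one_minus_power)
  have D0: "unit_at z (D 0)"
    unfolding D_def by (rule sum_den_unit)
  have den: "unit_at z ((1 - Y j) ^ 3 - x * Y j)" if "j < m" for j
  proof -
    have "vanishes_at z 1 (- (x * Y j))"
      using vanishes_at_uminus vanishes_at_mult_left[OF vanishes_at_mono[OF x] Yr] by simp
    from unit_at_add_vanishing[OF unit_at_power[OF Yu[OF that], of 3] this] show ?thesis
      by simp
  qed
  have E: "unit_at z (\<Prod>j<m. (1 - Y j) ^ 3 - x * Y j)"
    using den by (intro unit_at_prod) auto
  have \<epsilon>u: "(1 - u * Y j) * (1 - Y j / u) = (1 - Y j)\<^sup>2 - Y j * \<epsilon>" for j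
    unfolding \<epsilon>_def t_def u_def by (simp add: field_simps power2_eq_square)
  have "N x * (\<Prod>j<m. (1 - Y j) ^ 3 - x * Y j) * ratq ^ m
     = D x * t * W * (\<Prod>j<m. (1 - u * Y j) * (1 - Y j / u))"
    unfolding N_def D_def Y_def W_def t_def d
    by (rule sum_num_closed_form) (use ratq_power_neq_1 m(2) uq in \<open>simp_all add: x_def d\<close>)
  then have "N x = D x * t * W * (\<Prod>j<m. (1 - Y j)\<^sup>2 - Y j * \<epsilon>) / ((\<Prod>j<m. (1 - Y j) ^ 3 - x * Y j) * ratq ^ m)"
    unfolding \<epsilon>u using unit_at_nonzero[OF E] q0 by (simp add: eq_divide_eq mult.assoc)
  also have "\<dots> = D x * (t * W / ratq ^ m * H)"
    unfolding H_def prod_dividef by (simp add: mult_ac)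
  finally have Nx: "N x = D x * (t * W / ratq ^ m * H)" .
  have tW: "vanishes_at z 1 (t * W / ratq ^ m)"
    by (intro vanishes_at_divide vanishes_at_mult_left t Wr unit_ratq_power)
  have "vanishes_at z 4 (N x - N 0)"
    unfolding N_def by (rule vanishes_sum_num_diff[OF x])
  moreover have "vanishes_at z 4 ((D x - D 0) * (t * W / ratq ^ m * H))"
  proof -
    have "regular_at z H"
    proof -
      have "regular_at z \<epsilon>"
        unfolding \<epsilon>_def by (intro regular_at_divide regular_at_power vanishes_at_regular[OF t] unit_ratq_power)
      then show ?thesis
        unfolding H_def using den Yr Yu
        by (intro regular_at_prod regular_at_divide regular_at_diff regular_at_power regular_at_mult)
          (auto intro: regular_at_1)
    qed
    then show ?thesis
      using vanishes_at_mult[OF vanishes_sum_den_diff[OF x] vanishes_at_mult_left[OF tW]] unfolding D_def by simp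
  qed
  moreover have "vanishes_at z 4 (D 0 * (t * W / ratq ^ m * (H - H0)))"
  proof (rule vanishes_at_mult_right[OF unit_at_imp_regular_at[OF D0]])
    show "vanishes_at z 4 (t * W / ratq ^ m * (H - H0))"
      using vanishes_at_mult[OF tW HH] by (rule vanishes_at_mono) simp
  qed
  ultimately have "vanishes_at z 4 (- (N x - N 0) + (D x - D 0) * (t * W / ratq ^ m * H) + D 0 * (t * W / ratq ^ m * (H - H0)))"
    by (intro vanishes_at_add vanishes_at_uminus)
  also have "- (N x - N 0) + (D x - D 0) * (t * W / ratq ^ m * H) + D 0 * (t * W / ratq ^ m * (H - H0))
     = N 0 - D 0 * (t * W / ratq ^ m * H0)"
  proof -
    have "- (dx * (T * h) - n) + (dx - d) * (T * h) + d * (T * (h - h')) = n - d * (T * h')"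
      for dx d T h h' n :: "complex poly fract"
      by (simp add: algebra_simps)
    then show ?thesis
      unfolding Nx .
  qed
  finally have "vanishes_at z 4 ((N 0 - D 0 * (t * W / ratq ^ m * H0)) / D 0)"
    by (rule vanishes_at_divide[OF _ D0])
  also have "(N 0 - D 0 * (t * W / ratq ^ m * H0)) / D 0 = (\<Sum>k<d. ser_term k) - t * W / ratq ^ m * H0"
    unfolding sum_ser_term N_def D_def using unit_at_nonzero[OF sum_den_unit] by (simp add: diff_divide_distrib)
  also have "t * W / ratq ^ m * H0 = rhs_main m"
  proof -
    have "t\<^sup>2 * (\<Sum>j<m. Y j / (1 - Y j)\<^sup>2) = (\<Sum>j<m. Y j * (t / (1 - Y j))\<^sup>2)"
      by (simp add: sum_distrib_left power_divide mult.commute)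
    then show ?thesis
      unfolding H0_def rhs_main_def W prod_dividef Y_def[symmetric] d[symmetric] t_def[symmetric] by simp
  qed
  finally show ?thesis .
qed

text \<open>Besides the three zeros of the cubed factor, (q; q^4)_k contributes 1 - q^(4 m + 1) = 1
  - q^d, since m < k.\<close>

lemma vanishes_ser_term_4:
  assumes "d = 4 * m + 1" "(d - 1) div 2 < k" "k < d"
  shows "vanishes_at z 4 (ser_term k)"
proof -
  have "vanishes_at z 1 (\<Prod>j<k. 1 - ratq ^ (4 * j + 1))"
  proof (rule vanishes_at_prod)
    show "m \<in> {..<k}"
      using assms by simp
    show "vanishes_at z 1 (1 - ratq ^ (4 * m + 1))"
      unfolding assms(1)[symmetric] by (rule vanishes_at_one_minus_power[OF z_d])
  qed (simp_all only: finite_lessThan regular_at_one_minus_power)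
  moreover have "qpochhammer ratq (ratq ^ 4) k = (\<Prod>j<k. 1 - ratq ^ (4 * j + 1))"
    unfolding qpochhammer_def by (simp add: power_mult)
  ultimately have "vanishes_at z 1 (sum_weight ratq k)"
    unfolding sum_weight_def
    by (simp only:) (intro vanishes_at_mult_left vanishes_at_mult_right regular_at_one_minus_power regular_at_ratq_power)
  from vanishes_at_mult[OF this vanishes_num[OF assms(2,3)]] show ?thesis
    unfolding ser_term_def by simp
qed

lemma vanishes_partial_sum_minus_rhs:
  assumes d: "d = 4 * m + 1" and L: "(d - 1) div 2 < L" "L \<le> d"
  shows "vanishes_at z 4 ((\<Sum>k<L. ser_term k) - rhs_main m)"
proof -
  have "(\<Sum>k<d. ser_term k) = (\<Sum>k<L. ser_term k) + (\<Sum>j<d - L. ser_term (L + j))"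
    using sum_shift[of ser_term L "d - L"] L by simp
  then have eq: "(\<Sum>k<L. ser_term k) - rhs_main m = ((\<Sum>k<d. ser_term k) - rhs_main m) - (\<Sum>j<d - L. ser_term (L + j))"
    by simp
  have "vanishes_at z 4 (\<Sum>j<d - L. ser_term (L + j))"
    using L by (intro vanishes_at_sum vanishes_ser_term_4[OF d]) auto
  then show ?thesis
    unfolding eq by (rule vanishes_at_diff[OF vanishes_sum_minus_rhs[OF d]])
qed

end

section \<open>The two sides with the factor 1 / (1 - q) taken out\<close>

lemma qinteger_ratq: "qinteger ratq r = (1 - ratq ^ r) / (1 - ratq)"
  by (simp add: qinteger_def)

lemma lhs_eq:
  "(\<Sum>k=0..M. qinteger ratq (6 * k + 1)
       * (qpochhammer ratq (ratq ^ 2) k ^ 3 * qpochhammer ratq (ratq ^ 4) k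
          / (qpochhammer (ratq ^ 2) (ratq ^ 2) k * qpochhammer (ratq ^ 4) (ratq ^ 4) k ^ 3))
       * ratq ^ (k ^ 2 + k)) = (\<Sum>k<M + 1. ser_term k) / (1 - ratq)"
proof -
  have e: "ratq * (ratq\<^sup>2) ^ j = ratq ^ (2 * j + 1)" "ratq\<^sup>2 * (ratq\<^sup>2) ^ j = ratq ^ (2 * j + 2)"
    "ratq ^ 4 * (ratq ^ 4) ^ j = ratq ^ (4 * j + 4)" for j
    unfolding power_add power_mult power_one_right by (rule mult.commute)+
  have A: "qpochhammer ratq (ratq ^ 2) k ^ 3 / (qpochhammer (ratq ^ 2) (ratq ^ 2) k * qpochhammer (ratq ^ 4) (ratq ^ 4) k ^ 3)
     = (\<Prod>j<k. num_factor ratq 0 j / den_factor ratq 0 j)" for k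
    unfolding qpochhammer_def e num_factor_def den_factor_def
    by (simp only: mult_zero_left diff_zero add_0_right prod_dividef prod.distrib prod_power_distrib)
  have mv: "a * b / c = b * (a / c)" for a b c :: "complex poly fract"
    by simp
  have t: "qpochhammer ratq (ratq ^ 2) k ^ 3 * qpochhammer ratq (ratq ^ 4) k
      / (qpochhammer (ratq ^ 2) (ratq ^ 2) k * qpochhammer (ratq ^ 4) (ratq ^ 4) k ^ 3)
     = qpochhammer ratq (ratq ^ 4) k * (\<Prod>j<k. num_factor ratq 0 j / den_factor ratq 0 j)" for k
    by (subst mv) (simp only: A)
  have "{0..M} = {..<M + 1}"
    by auto
  then show ?thesis
    unfolding t qinteger_ratq ser_term_def sum_weight_def sum_divide_distrib
    by (intro sum.cong) (simp_all add: mult_ac)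
qed

lemma rhs_eq:
  "qinteger ratq (4 * m + 1) * ratq powi ((1 - int (4 * m + 1)) div 4)
       * (qpochhammer (ratq ^ 2) (ratq ^ 4) ((4 * m + 1 - 1) div 4)
          / qpochhammer (ratq ^ 4) (ratq ^ 4) ((4 * m + 1 - 1) div 4))
       * (1 - qinteger ratq (4 * m + 1) ^ 2
            * (\<Sum>j=1..(4 * m + 1 - 1) div 4. ratq ^ (4 * j) / qinteger ratq (4 * j) ^ 2))
   = rhs_main m / (1 - ratq)"
proof -
  define t where "t = 1 - ratq ^ (4 * m + 1)"
  have q1: "1 - ratq \<noteq> 0"
    using ratq_power_neq_1[of 1] by simp
  have e: "ratq\<^sup>2 * (ratq ^ 4) ^ j = ratq ^ (4 * j + 2)" "ratq ^ 4 * (ratq ^ 4) ^ j = ratq ^ (4 * j + 4)" for j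
    unfolding power_add power_mult by (rule mult.commute)+
  \<comment> \<open>Both integer divisions are exact, since n - 1 = 4 m.\<close>
  have i: "(1 - int (4 * m + 1)) div 4 = - int m" "(4 * m + 1 - 1) div 4 = m"
    by simp_all
  have p: "ratq powi (- int m) = inverse (ratq ^ m)"
    by (simp add: power_int_minus)
  have "(t / (1 - ratq))\<^sup>2 * (ratq ^ (4 * Suc j) / ((1 - ratq ^ (4 * Suc j)) / (1 - ratq))\<^sup>2)
     = ratq ^ (4 * j + 4) * (t / (1 - ratq ^ (4 * j + 4)))\<^sup>2" for j
  proof -
    have "4 * Suc j = 4 * j + 4"
      by simp
    then show ?thesis
      using q1 by (simp only: power_divide) (simp add: field_simps)
  qed
  then have S: "(t / (1 - ratq))\<^sup>2 * (\<Sum>j=1..m. ratq ^ (4 * j) / ((1 - ratq ^ (4 * j)) / (1 - ratq))\<^sup>2)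
     = (\<Sum>j<m. ratq ^ (4 * j + 4) * (t / (1 - ratq ^ (4 * j + 4)))\<^sup>2)"
    unfolding sum_distrib_left One_nat_def sum.atLeast1_atMost_eq by (rule sum.cong[OF refl])
  have Q: "qpochhammer (ratq\<^sup>2) (ratq ^ 4) m / qpochhammer (ratq ^ 4) (ratq ^ 4) m
     = (\<Prod>j<m. (1 - ratq ^ (4 * j + 2)) / (1 - ratq ^ (4 * j + 4)))"
    unfolding qpochhammer_def e prod_dividef ..
  show ?thesis
    unfolding i p qinteger_ratq t_def[symmetric] S Q rhs_main_def by (simp add: divide_inverse mult_ac)
qed

section \<open>From roots of unity to the modulus\<close>

lemma cis_power_eq_1_iff:
  assumes "0 < n"
  shows "cis (2 * pi * real k / real n) ^ i = 1 \<longleftrightarrow> n dvd k * i"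
proof -
  have "cis (2 * pi * real k / real n) ^ i = exp (2 * of_real pi * \<i> * of_nat (k * i) / of_nat n)"
    unfolding Complex.DeMoivre unfolding cis_conv_exp by (simp add: mult_ac)
  then show ?thesis
    using complex_root_unity_eq_1[of n "k * i"] assms by simp
qed

text \<open>The order is n itself exactly when k is coprime to n; it exceeds 1 because 0 < k < n,
  and it is odd as a divisor of n.\<close>

lemma primitive_root_cis:
  assumes "odd n" "0 < k" "k < n"
  shows "primitive_root (cis (2 * pi * real k / real n)) (n div gcd k n)"
proof -
  define g where "g = gcd k n"
  have g: "0 < g" "n = g * (n div g)" "k = g * (k div g)" "coprime (k div g) (n div g)"
    using assms by (auto simp: g_def intro!: div_gcd_coprime)
  have iff: "cis (2 * pi * real k / real n) ^ i = 1 \<longleftrightarrow> n div g dvd i" for i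
  proof -
    have "n dvd k * i \<longleftrightarrow> g * (n div g) dvd g * (k div g * i)"
      using g by (metis mult.assoc)
    also have "\<dots> \<longleftrightarrow> n div g dvd i"
      using g(1,4) by (simp add: coprime_commute coprime_dvd_mult_right_iff)
    finally show ?thesis
      using cis_power_eq_1_iff[of n k i] assms by simp
  qed
  have "g \<le> k"
    using assms by (simp add: g_def gcd_le1_nat)
  then have "g < n"
    using assms by simp
  show ?thesis
    unfolding g_def[symmetric]
  proof
    show "odd (n div g)"
      using assms(1) g(2) by (metis dvd_mult)
    show "1 < n div g"
    proof (rule ccontr)
      assume "\<not> 1 < n div g"
      then have "g * (n div g) \<le> g * 1"
        by (intro mult_le_mono2) simp
      then show False
        using \<open>g < n\<close> g(2) by simp
    qed
    show "cis (2 * pi * real k / real n) ^ (n div g) = 1"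
      by (simp add: iff)
    show "cis (2 * pi * real k / real n) ^ i \<noteq> 1" if "0 < i" "i < n div g" for i
      using that by (auto simp: iff dest: dvd_imp_le)
  qed
qed

lemma inj_on_cis_roots: "inj_on (\<lambda>k. cis (2 * pi * real k / real n)) {1..<n}"
proof (rule inj_onI)
  fix j k
  assume jk: "j \<in> {1..<n}" "k \<in> {1..<n}" "cis (2 * pi * real j / real n) = cis (2 * pi * real k / real n)"
  have "exp (2 * of_real pi * \<i> * of_nat l / of_nat n) = cis (2 * pi * real l / real n)" for l
    unfolding cis_conv_exp by (simp add: mult_ac)
  then have "j mod n = k mod n"
    using complex_root_unity_eq[of n j k] jk by simp
  then show "j = k"
    using jk by simp
qed

text \<open>The product of the distinct linear factors with 0 < k < n divides [n], whose degree is
  at most n - 1, so the two agree up to a constant. A primitive root is counted once there and three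
  times in the cube of the cyclotomic polynomial, hence the exponent 4.\<close>

lemma modulus_dvd:
  assumes "1 < n"
  shows "qinteger polq n * cyclotomic n ^ 3
     dvd (\<Prod>k\<in>{1..<n}. [:- cis (2 * pi * real k / real n), 1:] ^ (if coprime k n then 4 else 1))"
proof -
  define \<zeta> where "\<zeta> k = cis (2 * pi * real k / real n)" for k
  define R where "R = (\<Prod>k\<in>{1..<n}. [:- \<zeta> k, 1:])"
  have "1 - polq \<noteq> 0"
    by (simp add: one_pCons)
  have qi: "(1 - polq) * qinteger polq n = 1 - polq ^ n" "qinteger polq n = (\<Sum>i<n. polq ^ i)"
  proof -
    have "1 - polq ^ n = (1 - polq) * (\<Sum>i<n. polq ^ i)"
      by (rule one_diff_power_eq)
    then show "qinteger polq n = (\<Sum>i<n. polq ^ i)"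
      unfolding qinteger_def using \<open>1 - polq \<noteq> 0\<close> by simp
    then show "(1 - polq) * qinteger polq n = 1 - polq ^ n"
      by (simp only: one_diff_power_eq)
  qed
  have "1 - polq ^ n \<noteq> 0"
    using polq_power_neq_1[of n] assms by simp
  then have q0: "qinteger polq n \<noteq> 0"
    using qi(1) by (metis mult_zero_right)
  have "(\<Prod>k\<in>{1..<n}. [:- \<zeta> k, 1:] ^ 1) dvd qinteger polq n"
  proof (rule prod_linear_powers_dvd)
    show "inj_on \<zeta> {1..<n}"
      using inj_on_cis_roots[of n] unfolding \<zeta>_def .
    fix k
    assume k: "k \<in> {1..<n}"
    have "\<zeta> k ^ n = 1"
      unfolding \<zeta>_def using assms by (subst cis_power_eq_1_iff) auto
    moreover have "\<zeta> k ^ 1 \<noteq> 1"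
      unfolding \<zeta>_def using assms k by (subst cis_power_eq_1_iff) (auto dest: dvd_imp_le)
    ultimately have "poly (qinteger polq n) (\<zeta> k) = 0"
      using arg_cong[OF qi(1), of "\<lambda>p. poly p (\<zeta> k)"] by simp
    then show "[:- \<zeta> k, 1:] ^ 1 dvd qinteger polq n"
      by (simp add: poly_eq_0_iff_dvd)
  qed simp
  then obtain c where c: "qinteger polq n = R * c"
    by (auto simp: R_def elim!: dvdE)
  have "degree R = n - 1"
    unfolding R_def by (subst degree_prod_sum_eq) auto
  moreover have "degree (qinteger polq n) \<le> n - 1"
    unfolding qi(2) by (rule degree_sum_le) (auto intro: order.trans[OF degree_power_le])
  moreover have "degree (qinteger polq n) = degree R + degree c"
    using q0 unfolding c by (intro degree_mult_eq) auto
  ultimately have "degree c = 0"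
    by simp
  then have "is_unit c"
    using q0 c by (auto simp: is_unit_iff_degree)
  then have 1: "qinteger polq n dvd R"
    unfolding c by simp
  have "{k. k \<in> {1..n} \<and> coprime k n} = {k \<in> {1..<n}. coprime k n}"
    using assms by (auto simp: nat_less_le)
  then have "cyclotomic n = (\<Prod>k\<in>{k \<in> {1..<n}. coprime k n}. [:- \<zeta> k, 1:])"
    unfolding cyclotomic_def \<zeta>_def by (simp only:)
  also have "\<dots> = (\<Prod>k\<in>{1..<n}. if coprime k n then [:- \<zeta> k, 1:] else 1)"
    by (rule prod.inter_filter) simp
  finally have 2: "cyclotomic n = (\<Prod>k\<in>{1..<n}. if coprime k n then [:- \<zeta> k, 1:] else 1)" .
  have "R * cyclotomic n ^ 3 = (\<Prod>k\<in>{1..<n}. [:- \<zeta> k, 1:] ^ (if coprime k n then 4 else 1))"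
    unfolding R_def 2 prod_power_distrib prod.distrib[symmetric]
    by (intro prod.cong refl) (simp add: power_numeral_reduce)
  then show ?thesis
    using mult_dvd_mono[OF 1 dvd_refl[of "cyclotomic n ^ 3"]] unfolding \<zeta>_def by simp
qed

theorem theorem1p2:
  fixes n M :: nat
  assumes "n > 0" and "[n = 1] (mod 4)" and "M = (n - 1) div 2 \<or> M = n - 1"
  shows "ratfun_cong
    (\<Sum>k=0..M. qinteger ratq (6 * k + 1)
       * (qpochhammer ratq (ratq ^ 2) k ^ 3 * qpochhammer ratq (ratq ^ 4) k
          / (qpochhammer (ratq ^ 2) (ratq ^ 2) k * qpochhammer (ratq ^ 4) (ratq ^ 4) k ^ 3))
       * ratq ^ (k ^ 2 + k))
    (qinteger ratq n * ratq powi ((1 - int n) div 4)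
       * (qpochhammer (ratq ^ 2) (ratq ^ 4) ((n - 1) div 4)
          / qpochhammer (ratq ^ 4) (ratq ^ 4) ((n - 1) div 4))
       * (1 - qinteger ratq n ^ 2
            * (\<Sum>j=1..(n - 1) div 4. ratq ^ (4 * j) / qinteger ratq (4 * j) ^ 2)))
    (qinteger polq n * cyclotomic n ^ 3)"
proof -
  define m where "m = n div 4"
  have n: "n = 4 * m + 1"
    using assms(2) unfolding m_def cong_def by presburger
  define X where "X = (\<Sum>k<M + 1. ser_term k) / (1 - ratq)"
  define Z where "Z = rhs_main m / (1 - ratq)"
  define P where "P = qinteger polq n * cyclotomic n ^ 3"
  have "ratfun_cong X Z P"
  \<comment> \<open>For n = 1 the modulus is (q - 1)^3, and its root 1 is not among the points used
    for n > 1. Both sides are then equal to 1.\<close>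
  proof (cases "m = 0")
    case True
    have q1: "1 - ratq \<noteq> 0"
      using ratq_power_neq_1[of 1] by simp
    have "M = 0"
      using True n assms(3) by auto
    then have "X = 1" "Z = 1"
      using True q1 unfolding X_def Z_def rhs_main_def by (simp_all add: ser_term_def sum_weight_def)
    moreover have "denom_coprime 1 P"
      unfolding denom_coprime_def by (intro exI[of _ 1]) (simp add: One_fract_def)
    moreover have "\<exists>a b. b \<noteq> 0 \<and> (1 :: complex poly fract) - 1 = Fract a b \<and> P dvd a \<and> coprime b P"
      by (intro exI[of _ 0] exI[of _ 1]) (simp add: Zero_fract_def)
    ultimately show ?thesis
      unfolding ratfun_cong_def by simp
  next
    case False
    define \<zeta> where "\<zeta> k = cis (2 * pi * real k / real n)" for k
    define e where "e k = (if coprime k n then 4 else 1 :: nat)" for k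
    have "odd n" "1 < n"
      using n False by auto
    have main: "vanishes_at (\<zeta> k) (e k) (X - Z) \<and> regular_at (\<zeta> k) X \<and> regular_at (\<zeta> k) Z"
      if k: "k \<in> {1..<n}" for k
    proof -
      define d where "d = n div gcd k n"
      have "primitive_root (\<zeta> k) d"
        unfolding \<zeta>_def d_def using k \<open>odd n\<close> by (intro primitive_root_cis) auto
      then interpret primitive_root "\<zeta> k" d .
      have d_n: "d dvd n"
        unfolding d_def by (metis dvd_div_mult_self dvd_triv_left gcd_dvd2)
      \<comment> \<open>As d > 1, division by 1 - q changes no order at these points.\<close>
      have u: "unit_at (\<zeta> k) (1 - ratq)"
        using unit_at_one_minus_power[of "\<zeta> k" 1] power_eq_1_iff[of 1] d_gt_1 by simp
      have Z1: "vanishes_at (\<zeta> k) 1 (rhs_main m)"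
        using d_n unfolding n by (rule vanishes_rhs_main)
      \<comment> \<open>The M + 1 summands form \<open>a\<close> full blocks and a block truncated
        beyond its middle. For M = n - 1 the last block is complete and counted as L = d rather than
        0; for M = (n - 1) / 2 and n / d = 2 b + 1 there are b full blocks. When d = n no full block
        precedes, as the fourth-order comparison requires.\<close>
      obtain a L where aL: "M + 1 = a * d + L" "(d - 1) div 2 < L" "L \<le> d" "d = n \<Longrightarrow> a = 0"
      proof -
        obtain g where g: "n = d * g"
          using d_n ..
        have "odd g" "0 < g"
          using \<open>odd n\<close> g by (auto intro: odd_pos)
        then obtain b where b: "g = 2 * b + 1"
          by (elim oddE)
        from assms(3) show ?thesis
        proof
          assume "M = n - 1"
          then have "M + 1 = (g - 1) * d + d"
            using g \<open>0 < g\<close> assms(1) by (simp add: algebra_simps)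
          moreover have "d = n \<Longrightarrow> g - 1 = 0"
            using g d_gt_1 by simp
          ultimately show ?thesis
            using that[of "g - 1" d] d_gt_1 by simp
        next
          assume M: "M = (n - 1) div 2"
          have "n = 2 * (b * d) + d"
            unfolding g b by (simp add: algebra_simps)
          then have "M + 1 = b * d + ((d - 1) div 2 + 1)"
            using half unfolding M by presburger
          moreover have "d = n \<Longrightarrow> b = 0"
            using g b d_gt_1 by simp
          moreover have "(d - 1) div 2 + 1 \<le> d"
            using half d_gt_1 by presburger
          ultimately show ?thesis
            using that[of b "(d - 1) div 2 + 1"] by simp
        qed
      qed
      have X1: "vanishes_at (\<zeta> k) 1 (\<Sum>k<M + 1. ser_term k)"
        unfolding aL(1) using aL(2,3) by (rule vanishes_sum_ser_term_blocks)
      have "vanishes_at (\<zeta> k) (e k) ((\<Sum>k<M + 1. ser_term k) - rhs_main m)"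
      proof (cases "coprime k n")
        case True
        then have dn: "d = n"
          unfolding d_def coprime_imp_gcd_eq_1[OF True] by simp
        have Meq: "M + 1 = L"
          using aL(1) aL(4)[OF dn] by simp
        have dm: "d = 4 * m + 1"
          using dn n by (rule trans)
        show ?thesis
          unfolding e_def if_P[OF True] Meq by (rule vanishes_partial_sum_minus_rhs[OF dm aL(2,3)])
      next
        case False
        then show ?thesis
          unfolding e_def if_not_P[OF False] by (intro vanishes_at_diff X1 Z1)
      qed
      then have "vanishes_at (\<zeta> k) (e k) (X - Z)"
        unfolding X_def Z_def diff_divide_distrib[symmetric] using u by (rule vanishes_at_divide)
      moreover have "regular_at (\<zeta> k) X" "regular_at (\<zeta> k) Z"
        unfolding X_def Z_def by (intro regular_at_divide u vanishes_at_regular[OF X1] vanishes_at_regular[OF Z1])+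
      ultimately show ?thesis
        by blast
    qed
    have inj: "inj_on \<zeta> {1..<n}"
      using inj_on_cis_roots unfolding \<zeta>_def .
    have dvd: "P dvd (\<Prod>k\<in>{1..<n}. [:- \<zeta> k, 1:] ^ e k)"
      unfolding P_def \<zeta>_def e_def by (rule modulus_dvd[OF \<open>1 < n\<close>])
    have "denom_coprime X P" "denom_coprime Z P"
      using main dvd by (auto intro: regular_denom_coprime[of "{1..<n}" \<zeta>])
    moreover have "\<exists>a b. b \<noteq> 0 \<and> X - Z = Fract a b \<and> P dvd a \<and> coprime b P"
      using main dvd inj by (intro local_to_global[of "{1..<n}" \<zeta> e]) auto
    ultimately show ?thesis
      unfolding ratfun_cong_def by blast
  qed
  then show ?thesis
    unfolding X_def Z_def P_def lhs_eq n rhs_eq .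
qed

end
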